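(* Let $H(q)=\sum_{n=0}^\infty q^n(q^n)_n$. For $\tau\in\mathbb{H}$, $q=e^{2\pi i\tau}$, $$H(q)=\frac{q^{-\frac1{120}}}{2\eta(\tau)}\sum_{\varepsilon=(\varepsilon_1,\varepsilon_2)^T\in\{0,1\}^2}(-1)^{\varepsilon_1+\varepsilon_2}\Big(\widetilde\theta^{(2)}_{\mu_2+\varepsilon,c_1}(\tau)+\widetilde\theta^{(2)}_{\mu_2+\varepsilon,c_2}(\tau)\Big),$$ and the two halves coincide: $$\sum_{\varepsilon\in\{0,1\}^2}(-1)^{\varepsilon_1+\varepsilon_2}\widetilde\theta^{(2)}_{\mu_2+\varepsilon,c_1}(\tau)=\sum_{\varepsilon\in\{0,1\}^2}(-1)^{\varepsilon_1+\varepsilon_2}\widetilde\theta^{(2)}_{\mu_2+\varepsilon,c_2}(\tau).$$ Moreover, for every positive integer $N$, the first half $$\frac{q^{-1/120}}{2\eta(\tau)}\sum_{\varepsilon\in\{0,1\}^2}(-1)^{\varepsilon_1+\varepsilon_2}\widetilde\theta^{(2)}_{\mu_2+\varepsilon,c_1}(\tau)$$ converges to $H(e^{2\pi i/N})$ as $\tau=1/N+it$, $t\to0^+$; consequently $H(q)$ itself converges in this limit, with $\lim H(q)=2H(e^{2\pi i/N})$.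
   Context: For $\tau\in\mathbb{H}$ put $q=e^{2\pi i\tau}$, $q^r=e^{2\pi ir\tau}$ for $r\in\mathbb{Q}$; $(x)_n=\prod_{k=0}^{n-1}(1-xq^k)$ and $\eta(\tau)=q^{1/24}\prod_{n\ge1}(1-q^n)$. The series $H(q)$ converges for $|q|<1$; at $q=e^{2\pi i/N}$ all but finitely many of its terms vanish, and $H(e^{2\pi i/N})$ denotes this finite sum. False theta functions: $A=\begin{pmatrix}3&2\\2&3\end{pmatrix}$, $B(x,y)=x^TAy$, $Q(x)=\frac12B(x,x)$, $L=2\mathbb{Z}^2$, dual lattice $L^*=\frac12A^{-1}\mathbb{Z}^2$, $c_1=\frac1{\sqrt{15}}(3,-2)^T$, $c_2=\frac1{\sqrt{15}}(-2,3)^T$, $\mu_2=\frac12A^{-1}(1,1)^T=\frac1{10}(1,1)^T$. For $\mu\in L^*$ and $c\in\{c_1,c_2\}$, $\widetilde\theta^{(2)}_{\mu,c}(\tau)=\sum_{n\in L+\mu}\operatorname{sgn}(B(n,c))q^{Q(n)}$ with $\operatorname{sgn}(0)=0$. *)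

theory Defs
  imports "HOL-Analysis.Analysis"
begin

section \<open>The $q$-series\<close>

text \<open>Real powers of $q = e^{2\pi i\tau}$ are taken with respect to \<open>\<tau>\<close>, not with a branch of
  the logarithm of \<open>q\<close>.\<close>

definition qpow :: "complex \<Rightarrow> real \<Rightarrow> complex"
  where "qpow \<tau> r = exp (2 * of_real pi * \<i> * of_real r * \<tau>)"

definition qpoch :: "complex \<Rightarrow> complex \<Rightarrow> nat \<Rightarrow> complex"
  where "qpoch q x n = (\<Prod>k<n. 1 - x * q ^ k)"

definition H_term :: "complex \<Rightarrow> nat \<Rightarrow> complex"
  where "H_term q n = q ^ n * qpoch q (q ^ n) n"

definition H :: "complex \<Rightarrow> complex"
  where "H q = (\<Sum>n. H_term q n)"

definition dedekind_eta :: "complex \<Rightarrow> complex"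
  where "dedekind_eta \<tau> = qpow \<tau> (1/24) * (\<Prod>n. 1 - qpow \<tau> 1 ^ Suc n)"

text \<open>The two settings in which \<^term>\<open>H\<close> is used: an absolutely convergent series
  inside the unit disc, a finite sum at roots of unity.\<close>

lemma summable_H_term:
  assumes "norm q < 1"
  shows "summable (\<lambda>n. norm (H_term q n))"
proof (rule summable_comparison_test_ev)
  define C where "C = exp (\<Sum>k. norm q ^ k)"
  show "\<forall>\<^sub>F n in sequentially. norm (norm (H_term q n)) \<le> C * norm q ^ n"
  proof (rule always_eventually, rule allI)
    fix n
    have "norm (qpoch q (q ^ n) n) = (\<Prod>k<n. norm (1 - q ^ n * q ^ k))"
      by (simp add: qpoch_def prod_norm)
    also have "\<dots> \<le> (\<Prod>k<n. exp (norm q ^ k))"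
    proof (rule prod_mono, safe)
      fix k
      have "norm (1 - q ^ n * q ^ k) \<le> 1 + norm q ^ n * norm q ^ k"
        using norm_triangle_ineq4[of 1 "q ^ n * q ^ k"] by (simp add: norm_mult norm_power)
      also have "\<dots> \<le> 1 + norm q ^ k"
        using assms by (simp add: mult_left_le_one_le power_le_one)
      also have "\<dots> \<le> exp (norm q ^ k)"
        by (rule exp_ge_add_one_self)
      finally show "norm (1 - q ^ n * q ^ k) \<le> exp (norm q ^ k)" .
    qed simp
    also have "\<dots> = exp (\<Sum>k<n. norm q ^ k)"
      by (simp add: exp_sum)
    also have "\<dots> \<le> C"
      using assms by (auto simp: C_def intro!: sum_le_suminf summable_geometric)
    finally show "norm (norm (H_term q n)) \<le> C * norm q ^ n"
      by (simp add: H_term_def norm_mult norm_power mult.commute[of C] mult_left_mono)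
  qed
  show "summable (\<lambda>n. C * norm q ^ n)"
    using assms by (intro summable_mult summable_geometric) simp
qed

lemma H_root_of_unity:
  assumes "q ^ N = 1" and "N > 0"
  shows "H q = (\<Sum>n<N. H_term q n)"
proof -
  have "H_term q n = 0" if "N \<le> n" for n
  proof -
    define k where "k = (N - n mod N) mod N"
    have "n mod N < N" using assms by simp
    then have "N dvd n + k"
      unfolding k_def by (metis add.commute le_add_diff_inverse2 less_imp_le
          mod_add_left_eq mod_add_right_eq mod_eq_0_iff_dvd mod_self)
    then have "q ^ (n + k) = 1"
      using assms by (auto simp: power_mult)
    moreover have "k < n"
      using mod_less_divisor[OF assms(2), of "N - n mod N"] that by (simp only: k_def)
    ultimately show ?thesis
      by (auto simp: H_term_def qpoch_def power_add intro!: bexI[of _ k])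
  qed
  then show ?thesis
    unfolding H_def by (intro suminf_finite) auto
qed

section \<open>False theta functions\<close>

definition matA :: "real^2^2"
  where "matA = vector [vector [3, 2], vector [2, 3]]"

definition formB :: "real^2 \<Rightarrow> real^2 \<Rightarrow> real"
  where "formB x y = x \<bullet> (matA *v y)"

definition formQ :: "real^2 \<Rightarrow> real"
  where "formQ x = formB x x / 2"

definition latL :: "(real^2) set"
  where "latL = {x. \<forall>i. \<exists>k::int. x $ i = 2 * of_int k}"

definition c1 :: "real^2"
  where "c1 = (1 / sqrt 15) *\<^sub>R vector [3, -2]"

definition c2 :: "real^2"
  where "c2 = (1 / sqrt 15) *\<^sub>R vector [-2, 3]"

definition mu2 :: "real^2"
  where "mu2 = (1/2) *\<^sub>R (matrix_inv matA *v vector [1, 1])"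

lemma mu2_eq: "mu2 = vector [1/10, 1/10]"
proof -
  have "invertible matA"
    by (simp add: invertible_det_nz det_2 matA_def)
  then have inv: "matrix_inv matA ** matA = mat 1"
    unfolding invertible_def matrix_inv_def by (rule someI2_ex) simp
  have "matA *v vector [1/5, 1/5] = vector [1, 1]"
    by (simp add: matA_def vec_eq_iff forall_2 matrix_vector_mult_def sum_2)
  then have "matrix_inv matA *v vector [1, 1] = (vector [1/5, 1/5] :: real^2)"
    by (metis inv matrix_vector_mul_assoc matrix_vector_mul_lid)
  then show ?thesis
    by (simp add: mu2_def vec_eq_iff forall_2)
qed

text \<open>Unordered summation over the coset \<open>L + \<mu>\<close>; the form \<^term>\<open>formQ\<close> is positive definite, so
  the sum converges absolutely for \<^term>\<open>Im \<tau> > 0\<close>.\<close>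

definition false_theta :: "real^2 \<Rightarrow> real^2 \<Rightarrow> complex \<Rightarrow> complex"
  where "false_theta \<mu> c \<tau> =
    (\<Sum>\<^sub>\<infinity>n \<in> (\<lambda>l. l + \<mu>) ` latL. of_real (sgn (formB n c)) * qpow \<tau> (formQ n))"

definition eps_vec :: "nat \<times> nat \<Rightarrow> real^2"
  where "eps_vec \<epsilon> = vector [real (fst \<epsilon>), real (snd \<epsilon>)]"

end

theory Submission
  imports Defs
begin

text \<open>
  Write \<open>U n r\<close> for the central Gaussian binomial \<open>[2n+1; n-r]\<close> and
  \<open>p r = (-1)^r q^(r(3r+1)/2)\<close>. A finite form of the pentagonal number theorem says
  \<open>(q^(n+1))_(n+1) = (\<Sum>r. p r * U n r)\<close>, so the partial sums of \<open>H\<close> are combinations of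
  the sums \<open>d s = (\<Sum>n<M. q^n * U n s)\<close>. The latter satisfy
  \<open>d s = q^(4s+8) d (s+3) + q^s U M (s+1) - q^(3s+4) U M (s+2)\<close>, and this one recurrence is used twice.

  For \<open>|q| < 1\<close> and \<open>M \<rightarrow> \<infinity>\<close> the inhomogeneity becomes \<open>(q^s - q^(3s+4)) / (q)_\<infinity>\<close> and iteration
  gives a partial theta series, hence the double series of the theorem. Its inner sums are translates
  of the pentagonal series (or vanish), so \<open>H\<close> is a single false theta series with exponents
  \<open>(15m^2+m)/2\<close> and \<open>(15m^2+11m+2)/2\<close>. At a primitive \<open>N\<close>-th root of unity its coefficients are
  antiperiodic modulo \<open>N\<close>, and the radial limit is a sum over one period.

  At the root of unity itself, taking \<open>M = N - 1\<close> makes all \<open>U M r\<close> explicit, and the recurrence has the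
  particular solution \<open>(-1)^(s+1) q^(-s(s+1)/2-1)\<close>. The remaining homogeneous part reproduces
  the terms of the same false theta series, over two thirds of a period; a symmetry
  depending on \<open>N\<close> modulo 3 identifies this with half of the sum over the full period.
\<close>

section \<open>Gaussian binomial coefficients\<close>

lemma powi_mult_powi:
  fixes q :: complex
  assumes "q \<noteq> 0"
  shows "q powi a * q powi b = q powi (a + b)" "q powi a * (q powi b * c) = q powi (a + b) * c"
  using assms by (simp_all add: power_int_add)

text \<open>Pascal's rule instead of a quotient of products, so that the values exist at roots of
  unity as well. Integer lower indices make the entries outside the triangle vanish, which removes
  boundary cases from the recurrences.\<close>

primrec qbinom :: "complex \<Rightarrow> nat \<Rightarrow> int \<Rightarrow> complex" where
  "qbinom q 0 k = (if k = 0 then 1 else 0)"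
| "qbinom q (Suc n) k = qbinom q n (k - 1) + q powi k * qbinom q n k"

lemma qbinom_eq_0: "k < 0 \<or> int n < k \<Longrightarrow> qbinom q n k = 0"
  by (induction n arbitrary: k) auto

lemma qbinom_0_right [simp]: "qbinom q n 0 = 1"
  by (induction n) (auto simp: qbinom_eq_0)

text \<open>The quotient of neighbouring entries with denominators cleared, hence meaningful also
  where \<open>1 - q powi (k + 1)\<close> vanishes.\<close>

lemma qbinom_ratio:
  assumes "q \<noteq> 0"
  shows "(1 - q powi (k + 1)) * qbinom q n (k + 1) = (1 - q powi (int n - k)) * qbinom q n k"
proof (induction n arbitrary: k)
  case 0
  then show ?case by auto
next
  case (Suc n)
  have IH1: "(1 - q powi k) * qbinom q n k = (1 - q powi (int n - k + 1)) * qbinom q n (k - 1)"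
    using Suc[of "k - 1"] by (simp add: algebra_simps)
  have e1: "q powi (k + 1) * q powi (int n - k) = q powi (int n + 1)"
    and e2: "q powi k * q powi (int n - k + 1) = q powi (int n + 1)"
    using assms by (simp_all flip: power_int_add add: algebra_simps)
  have "(1 - q powi (k + 1)) * qbinom q (Suc n) (k + 1)
      = (1 - q powi (k + 1)) * qbinom q n k
        + q powi (k + 1) * ((1 - q powi (k + 1)) * qbinom q n (k + 1))"
    by (simp add: algebra_simps)
  also have "\<dots> = (1 - q powi (int n + 1)) * qbinom q n k"
    unfolding Suc e1[symmetric] by (simp add: algebra_simps)
  also have "\<dots> = (1 - q powi k) * qbinom q n k
      + q powi k * (1 - q powi (int n - k + 1)) * qbinom q n k"
    unfolding e2[symmetric] by (simp add: algebra_simps)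
  also have "\<dots> = (1 - q powi (int n - k + 1)) * qbinom q (Suc n) k"
    unfolding IH1 by (simp add: algebra_simps)
  finally show ?case by (simp add: algebra_simps)
qed

text \<open>The second Pascal rule differs from the defining one exactly by
  \<open>qbinom_ratio\<close> at \<open>k - 1\<close>.\<close>

lemma qbinom_Suc':
  assumes "q \<noteq> 0"
  shows "qbinom q (Suc n) k = qbinom q n k + q powi (int n + 1 - k) * qbinom q n (k - 1)"
proof -
  have "(1 - q powi k) * qbinom q n k = (1 - q powi (int n + 1 - k)) * qbinom q n (k - 1)"
    using qbinom_ratio[OF assms, of "k - 1" n] by (simp add: algebra_simps)
  then show ?thesis by (simp add: algebra_simps)
qed

text \<open>Reflecting the lower index exchanges the two Pascal rules.\<close>

lemma qbinom_symmetric: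
  assumes "q \<noteq> 0"
  shows "qbinom q n (int n - k) = qbinom q n k"
proof (induction n arbitrary: k)
  case 0
  then show ?case by auto
next
  case (Suc n)
  have "qbinom q (Suc n) (int (Suc n) - k)
      = qbinom q n (int n - k) + q powi (int n + 1 - k) * qbinom q n (int n - (k - 1))"
    by (simp add: algebra_simps)
  then show ?case unfolding Suc qbinom_Suc'[OF assms] by simp
qed

text \<open>The odd row \<open>2 * n + 1\<close> turns the symmetry into
  \<open>r \<mapsto> - 1 - r\<close>, the reflection that also pairs the pentagonal exponents in
  \<open>pterm_reflect\<close>.\<close>

definition midbin :: "complex \<Rightarrow> nat \<Rightarrow> int \<Rightarrow> complex"
  where "midbin q n r = qbinom q (2 * n + 1) (int n - r)"

lemma midbin_reflect: "q \<noteq> 0 \<Longrightarrow> midbin q n (- 1 - r) = midbin q n r"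
  using qbinom_symmetric[of q "2 * n + 1" "int n - r"] by (simp add: midbin_def algebra_simps)

lemma midbin_eq_0: "int n < r \<or> r < - 1 - int n \<Longrightarrow> midbin q n r = 0"
  unfolding midbin_def by (rule qbinom_eq_0) auto

lemma midbin_0: "midbin q 0 r = (if r = 0 \<or> r = - 1 then 1 else 0)"
  by (auto simp: midbin_def)

lemma midbin_ratio:
  assumes "q \<noteq> 0"
  shows "(1 - q powi (int n - r)) * midbin q n r
       = (1 - q powi (int n + r + 2)) * midbin q n (r + 1)"
  using qbinom_ratio[OF assms, of "int n - r - 1" "2 * n + 1"]
  by (simp add: midbin_def algebra_simps)

text \<open>Raising \<open>n\<close> by one adds two to the row, so Pascal's rule is applied twice,
  once in each form.\<close>

lemma midbin_Suc:
  assumes "q \<noteq> 0"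
  shows "midbin q (Suc n) r = q powi (int n + 1 - r) * midbin q n (r - 1)
     + (1 + q powi (2 * int n + 2)) * midbin q n r + q powi (int n + r + 2) * midbin q n (r + 1)"
proof -
  let ?k = "int n + 1 - r" and ?m = "2 * n + 1"
  have "midbin q (Suc n) r = qbinom q (Suc (Suc ?m)) ?k"
    by (simp add: midbin_def algebra_simps)
  also have "\<dots> = qbinom q (Suc ?m) ?k + q powi (int n + r + 2) * qbinom q (Suc ?m) (?k - 1)"
    unfolding qbinom_Suc'[OF assms, of "Suc ?m"] by (simp add: algebra_simps)
  also have "qbinom q (Suc ?m) ?k = midbin q n r + q powi ?k * midbin q n (r - 1)"
    by (simp add: midbin_def algebra_simps)
  also have "qbinom q (Suc ?m) (?k - 1) = midbin q n (r + 1) + q powi (int n - r) * midbin q n r"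
    by (simp add: midbin_def algebra_simps)
  also have "q powi (int n + r + 2) * (midbin q n (r + 1) + q powi (int n - r) * midbin q n r)
     = q powi (int n + r + 2) * midbin q n (r + 1) + q powi (2 * int n + 2) * midbin q n r"
    using assms by (simp add: distrib_left powi_mult_powi) 
  finally show ?thesis by (simp add: algebra_simps)
qed

section \<open>A finite pentagonal number theorem\<close>

definition pent :: "int \<Rightarrow> int"
  where "pent r = r * (3 * r + 1) div 2"

lemma two_pent: "2 * pent r = r * (3 * r + 1)"
proof -
  have "even (r * (3 * r + 1))" by auto
  then show ?thesis unfolding pent_def by simp
qed

lemma pent_Suc: "pent (r + 1) = pent r + 3 * r + 2"
  using two_pent[of r] two_pent[of "r + 1"] by (simp add: algebra_simps)

lemma pent_reflect: "pent (- 1 - r) = pent r + 2 * r + 1"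
  using two_pent[of r] two_pent[of "- 1 - r"] by (simp add: algebra_simps)

definition pterm :: "complex \<Rightarrow> int \<Rightarrow> complex"
  where "pterm q r = (- 1) powi r * q powi pent r"

lemma pterm_Suc: "q \<noteq> 0 \<Longrightarrow> pterm q (r + 1) = - (q powi (3 * r + 2) * pterm q r)"
  unfolding pterm_def pent_Suc by (simp add: power_int_add)

lemma pterm_pred: "q \<noteq> 0 \<Longrightarrow> pterm q (r - 1) = - (q powi (1 - 3 * r) * pterm q r)"
  using pterm_Suc[of q "r - 1"] by (simp add: powi_mult_powi)

lemma powi_minus_one_reflect: "(- 1 :: complex) powi (- 1 - r) = - ((- 1) powi r)"
  by (simp add: power_int_diff power_int_minus_one_minus divide_inverse flip: power_int_minus)

lemma pterm_reflect: "q \<noteq> 0 \<Longrightarrow> pterm q (- 1 - r) = - (q powi (2 * r + 1) * pterm q r)"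
  unfolding pterm_def pent_reflect powi_minus_one_reflect
  by (simp add: algebra_simps flip: power_int_add)

lemma sum_shift_finite_support:
  fixes g :: "int \<Rightarrow> 'a :: comm_monoid_add"
  assumes "g K = 0" "g (- 2 - K) = 0"
  shows "(\<Sum>r\<in>{- 1 - K..K}. g (r - 1)) = (\<Sum>r\<in>{- 1 - K..K}. g r)"
  by (rule sum.reindex_bij_witness_not_neutral[of "{- 1 - K}" "{K}" _ "\<lambda>r. r + 1" "\<lambda>r. r - 1"])
     (use assms in auto)

lemma sum_reflect:
  fixes g :: "int \<Rightarrow> 'a :: comm_monoid_add"
  shows "(\<Sum>r\<in>{- 1 - K..K}. g (- 1 - r)) = (\<Sum>r\<in>{- 1 - K..K}. g r)"
  by (rule sum.reindex_bij_witness[of _ "\<lambda>r. - 1 - r" "\<lambda>r. - 1 - r"]) auto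

text \<open>Both sides are the product of the \<open>n + 3\<close> factors with exponents from
  \<open>n + 1\<close> to \<open>2 * n + 3\<close>, split off at the lower or at the upper
  end.\<close>

lemma qpoch_power_Suc:
  "(1 - q ^ Suc n) * qpoch q (q ^ Suc (Suc n)) (Suc (Suc n))
   = qpoch q (q ^ Suc n) (Suc n) * (1 - q ^ (2 * n + 2)) * (1 - q ^ (2 * n + 3))"
proof -
  have "(1 - q ^ Suc n) * qpoch q (q ^ Suc (Suc n)) (Suc (Suc n))
      = (\<Prod>k<Suc (Suc (Suc n)). 1 - q ^ Suc n * q ^ k)"
    unfolding prod.lessThan_Suc_shift[of _ "Suc (Suc n)"] qpoch_def by (simp add: mult_ac)
  also have "\<dots> = qpoch q (q ^ Suc n) (Suc n) * (1 - q ^ (Suc n + Suc n)) * (1 - q ^ (Suc n + Suc (Suc n)))"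
    unfolding prod.lessThan_Suc[of _ "Suc (Suc n)"] prod.lessThan_Suc[of _ "Suc n"] qpoch_def power_add ..
  also have "Suc n + Suc n = 2 * n + 2" by simp
  also have "Suc n + Suc (Suc n) = 2 * n + 3" by simp
  finally show ?thesis .
qed

text \<open>The induction step of the finite pentagonal theorem. Expanding by
  \<open>midbin_Suc\<close> and shifting indices leaves a weighted sum over row \<open>n\<close>;
  the weight differs from the constant factor by terms whose sums vanish. The bound on
  \<open>K\<close> keeps the support of both rows inside the interval, so that the shifts lose
  nothing.\<close>

lemma midbin_pent_Suc:
  assumes q: "q \<noteq> 0" and K: "int n + 1 < K"
  shows "(\<Sum>r\<in>{- 1 - K..K}. pterm q r * midbin q (Suc n) r)
       = (1 + q ^ (n + 1)) * (1 - q ^ (2 * n + 3)) * (\<Sum>r\<in>{- 1 - K..K}. pterm q r * midbin q n r)"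
proof -
  let ?S = "{- 1 - K..K}"
  define V where "V r = pterm q r * midbin q n r" for r
  have V0: "V r = 0" if "r \<ge> K - 1 \<or> r \<le> - K" for r
    using that K by (auto simp: V_def midbin_eq_0)
  have V_reflect: "V (- 1 - r) = - (q powi (2 * r + 1) * V r)" for r
    using q by (simp add: V_def pterm_reflect midbin_reflect)
  \<comment> \<open>By \<open>V_reflect\<close> the reflected summand is the negative of the
    original one, so the sum is its own negative.\<close>
  have antisym: "(\<Sum>r\<in>?S. q powi r * V r) = 0" (is "?A = 0")
  proof -
    have "?A = (\<Sum>r\<in>?S. q powi (- 1 - r) * V (- 1 - r))"
      by (rule sum_reflect[symmetric])
    also have "\<dots> = - ?A"
      unfolding V_reflect sum_negf[symmetric]
      using q by (intro sum.cong) (auto simp: powi_mult_powi)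
    finally show ?thesis by simp
  qed
  have antisym': "(\<Sum>r\<in>?S. V r) + (\<Sum>r\<in>?S. q powi (2 * r + 1) * V r) = 0"
    using sum_reflect[of V K] unfolding V_reflect sum_negf by (metis add.left_inverse)
  \<comment> \<open>The summand is \<open>c r - c (r - 1)\<close>, written as a multiple of
    \<open>V r\<close> by means of \<open>midbin_ratio\<close> and \<open>pterm_pred\<close>. The
    exponent \<open>y\<close> is free; two choices of it are used below.\<close>
  have tele: "(\<Sum>r\<in>?S. (q powi y r * (1 - q powi (int n - r))
       + q powi (1 - 3 * r + y (r - 1)) * (1 - q powi (int n + r + 1))) * V r) = 0" for y
  proof -
    define c where "c r = q powi y r * (1 - q powi (int n - r)) * V r" for r
    have "c (r - 1) = - (q powi (1 - 3 * r + y (r - 1)) * (1 - q powi (int n + r + 1)) * V r)" for r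
    proof -
      have "c (r - 1) = q powi y (r - 1) * pterm q (r - 1) * ((1 - q powi (int n - (r - 1))) * midbin q n (r - 1))"
        by (simp add: c_def V_def)
      also have "\<dots> = q powi y (r - 1) * - (q powi (1 - 3 * r) * pterm q r) * ((1 - q powi (int n + r + 1)) * midbin q n r)"
        unfolding midbin_ratio[OF q] pterm_pred[OF q] by (simp add: algebra_simps)
      finally show ?thesis using q by (simp add: V_def power_int_add)
    qed
    then have "(\<Sum>r\<in>?S. (q powi y r * (1 - q powi (int n - r))
       + q powi (1 - 3 * r + y (r - 1)) * (1 - q powi (int n + r + 1))) * V r)
      = (\<Sum>r\<in>?S. c r) - (\<Sum>r\<in>?S. c (r - 1))"
      unfolding sum_subtractf[symmetric]
      by (intro sum.cong) (auto simp: c_def algebra_simps)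
    also have "\<dots> = 0"
      using sum_shift_finite_support[of c K] by (simp add: c_def V0)
    finally show ?thesis .
  qed
  have "(\<Sum>r\<in>?S. pterm q r * midbin q (Suc n) r)
      = (\<Sum>r\<in>?S. pterm q r * q powi (int n + 1 - r) * midbin q n (r - 1))
        + (\<Sum>r\<in>?S. (1 + q powi (2 * int n + 2)) * V r)
        + (\<Sum>r\<in>?S. pterm q r * q powi (int n + r + 2) * midbin q n (r + 1))"
    unfolding midbin_Suc[OF q] V_def sum.distrib[symmetric] by (simp add: algebra_simps)
  also have "(\<Sum>r\<in>?S. pterm q r * q powi (int n + 1 - r) * midbin q n (r - 1))
      = (\<Sum>r\<in>?S. - (q powi (int n + 2 * r + 2) * V r))"
  proof -
    have "pterm q r * q powi (int n + 1 - r) = - (q powi (int n + 2 * (r - 1) + 2) * pterm q (r - 1))" for r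
      unfolding pterm_pred[OF q] using q by (simp add: powi_mult_powi algebra_simps)
    then show ?thesis
      using sum_shift_finite_support[of "\<lambda>r. - (q powi (int n + 2 * r + 2) * V r)" K]
      by (simp add: V0) (simp add: V_def mult.assoc)
  qed
  also have "(\<Sum>r\<in>?S. pterm q r * q powi (int n + r + 2) * midbin q n (r + 1))
      = (\<Sum>r\<in>?S. - (q powi (int n - 2 * r + 2) * V r))"
  proof -
    have "pterm q r * q powi (int n + r + 2) = - (q powi (int n - 2 * (r + 1) + 2) * pterm q (r + 1))" for r
      unfolding pterm_Suc[OF q] using q by (simp add: powi_mult_powi algebra_simps)
    then show ?thesis
      using sum_shift_finite_support[of "\<lambda>r. - (q powi (int n - 2 * (r + 1) + 2) * V (r + 1))" K]
      by (simp add: V0) (simp add: V_def mult.assoc)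
  qed
  finally have "(\<Sum>r\<in>?S. pterm q r * midbin q (Suc n) r) = 
     (\<Sum>r\<in>?S. (1 + q powi (2 * int n + 2) - q powi (int n + 2 * r + 2) - q powi (int n - 2 * r + 2)) * V r)"
    by (simp add: algebra_simps sum.distrib sum_subtractf sum_negf)
  \<comment> \<open>Modulo the expected factor, the weight is a combination of two telescoping sums (\<open>tele\<close>) and of
      terms that are antisymmetric under \<open>r \<mapsto> - 1 - r\<close>.\<close>
  also have "\<dots> = (\<Sum>r\<in>?S. (1 + q ^ (n + 1)) * (1 - q ^ (2 * n + 3)) * V r
       - ((q powi (int n + r + 2) * (1 - q powi (int n - r))
       + q powi (1 - 3 * r + (int n + (r - 1) + 2)) * (1 - q powi (int n + r + 1))) * V r)
       - ((q powi (2 * int n + 2 * r + 4) * (1 - q powi (int n - r))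
       + q powi (1 - 3 * r + (2 * int n + 2 * (r - 1) + 4)) * (1 - q powi (int n + r + 1))) * V r)
       - ((q powi (int n + 1) - q powi (2 * int n + 3)) * (V r + q powi (2 * r + 1) * V r)
       + (q powi (3 * int n + 4) - q powi (int n + 2)) * (q powi r * V r)))"
  proof (rule sum.cong[OF refl])
    fix r
    have *: "q ^ (n + 1) = q powi (int n + 1)" "q ^ (2 * n + 3) = q powi (2 * int n + 3)"
      by (simp_all flip: power_int_of_nat add: algebra_simps)
    show "(1 + q powi (2 * int n + 2) - q powi (int n + 2 * r + 2) - q powi (int n - 2 * r + 2)) * V r =
      (1 + q ^ (n + 1)) * (1 - q ^ (2 * n + 3)) * V r
       - ((q powi (int n + r + 2) * (1 - q powi (int n - r))
       + q powi (1 - 3 * r + (int n + (r - 1) + 2)) * (1 - q powi (int n + r + 1))) * V r)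
       - ((q powi (2 * int n + 2 * r + 4) * (1 - q powi (int n - r))
       + q powi (1 - 3 * r + (2 * int n + 2 * (r - 1) + 4)) * (1 - q powi (int n + r + 1))) * V r)
       - ((q powi (int n + 1) - q powi (2 * int n + 3)) * (V r + q powi (2 * r + 1) * V r)
       + (q powi (3 * int n + 4) - q powi (int n + 2)) * (q powi r * V r))"
      unfolding * using q by (simp add: powi_mult_powi algebra_simps)
  qed
  also have "\<dots> = (1 + q ^ (n + 1)) * (1 - q ^ (2 * n + 3)) * (\<Sum>r\<in>?S. V r)"
    unfolding sum_subtractf sum.distrib sum_distrib_left[symmetric]
      tele[of "\<lambda>r. int n + r + 2"] tele[of "\<lambda>r. 2 * int n + 2 * r + 4"] antisym antisym'
    by simp
  finally show ?thesis by (simp add: V_def)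
qed

text \<open>Row 0 gives \<open>1 - q\<close>, and both sides grow by the same factor with
  \<open>n\<close>. On the right this factor appears after cancelling \<open>1 - q ^ Suc n\<close>,
  which the second hypothesis allows; being limited to \<open>k \<le> n\<close>, it also holds at
  primitive roots of unity of order above \<open>n\<close>.\<close>

lemma finite_pentagonal:
  assumes q: "q \<noteq> 0" "\<And>k. 0 < k \<Longrightarrow> k \<le> n \<Longrightarrow> q ^ k \<noteq> 1" and K: "int n < K"
  shows "(\<Sum>r\<in>{- 1 - K..K}. pterm q r * midbin q n r) = qpoch q (q ^ Suc n) (Suc n)"
  using q(2) K
proof (induction n)
  case 0
  have "(\<Sum>r\<in>{- 1 - K..K}. pterm q r * midbin q 0 r) = (\<Sum>r\<in>{0, - 1}. pterm q r * midbin q 0 r)"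
    using 0 by (intro sum.mono_neutral_right) (auto simp: midbin_0)
  then show ?case using pterm_reflect[OF q(1), of 0]
    by (simp add: midbin_0 qpoch_def) (simp add: pterm_def pent_def)
next
  case (Suc n)
  have IH: "(\<Sum>r\<in>{- 1 - K..K}. pterm q r * midbin q n r) = qpoch q (q ^ Suc n) (Suc n)"
    using Suc by auto
  have ne: "1 - q ^ Suc n \<noteq> 0"
    using Suc.prems(1)[of "Suc n"] by auto
  have "(1 - q ^ Suc n) * qpoch q (q ^ Suc (Suc n)) (Suc (Suc n))
      = (1 - q ^ Suc n) * ((1 + q ^ (n + 1)) * (1 - q ^ (2 * n + 3)) * qpoch q (q ^ Suc n) (Suc n))"
  proof -
    have "1 - q ^ (2 * n + 2) = (1 - q ^ Suc n) * (1 + q ^ (n + 1))"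
      by (simp add: algebra_simps flip: power_add mult_2)
    then show ?thesis unfolding qpoch_power_Suc by (simp only: mult_ac)
  qed
  then have "qpoch q (q ^ Suc (Suc n)) (Suc (Suc n))
      = (1 + q ^ (n + 1)) * (1 - q ^ (2 * n + 3)) * qpoch q (q ^ Suc n) (Suc n)"
    using ne mult_left_cancel by blast
  then show ?case
    using midbin_pent_Suc[OF q(1), of n K] Suc.prems IH by simp
qed

text \<open>The indices \<open>s\<close> and \<open>- 1 - s\<close> carry the same binomial by
  \<open>midbin_reflect\<close>; joining their coefficients leaves a sum over the naturals.\<close>

definition pcoeff :: "complex \<Rightarrow> nat \<Rightarrow> complex"
  where "pcoeff q s = pterm q (int s) + pterm q (- 1 - int s)"

lemma finite_pentagonal_nat:
  assumes q: "q \<noteq> 0" "\<And>k. 0 < k \<Longrightarrow> k \<le> n \<Longrightarrow> q ^ k \<noteq> 1" and M: "n < M"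
  shows "(\<Sum>s<M. pcoeff q s * midbin q n (int s)) = qpoch q (q ^ Suc n) (Suc n)"
proof -
  let ?f = "\<lambda>r. pterm q r * midbin q n r"
  have "(\<Sum>r\<in>{- 1 - int M..int M}. ?f r) = (\<Sum>r\<in>int ` {..<M} \<union> (\<lambda>s. - 1 - int s) ` {..<M}. ?f r)"
  proof (rule sum.mono_neutral_right)
    show "\<forall>r\<in>{- 1 - int M..int M} - (int ` {..<M} \<union> (\<lambda>s. - 1 - int s) ` {..<M}). ?f r = 0"
    proof
      fix r assume r: "r \<in> {- 1 - int M..int M} - (int ` {..<M} \<union> (\<lambda>s. - 1 - int s) ` {..<M})"
      have "int n < r \<or> r < - 1 - int n"
      proof (cases "r \<ge> 0")
        case True
        then have "r = int (nat r)" by simp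
        then have "\<not> nat r < M" using r by blast
        then show ?thesis using M True by auto
      next
        case False
        then have "r = - 1 - int (nat (- 1 - r))" by simp
        then have "\<not> nat (- 1 - r) < M" using r by blast
        then show ?thesis using M False by auto
      qed
      then show "?f r = 0" by (simp add: midbin_eq_0)
    qed
  qed auto
  also have "\<dots> = (\<Sum>r\<in>int ` {..<M}. ?f r) + (\<Sum>r\<in>(\<lambda>s. - 1 - int s) ` {..<M}. ?f r)"
    by (rule sum.union_disjoint) auto
  also have "\<dots> = (\<Sum>s<M. ?f (int s)) + (\<Sum>s<M. ?f (- 1 - int s))"
    by (simp add: sum.reindex inj_on_def)
  also have "\<dots> = (\<Sum>s<M. pcoeff q s * midbin q n (int s))"
    unfolding midbin_reflect[OF q(1)] sum.distrib[symmetric] by (simp add: pcoeff_def distrib_right)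
  finally show ?thesis using finite_pentagonal[OF q, where K = "int M"] M by simp
qed

section \<open>A three-step recurrence\<close>

definition dsum :: "complex \<Rightarrow> nat \<Rightarrow> int \<Rightarrow> complex"
  where "dsum q M r = (\<Sum>n<M. q ^ n * midbin q n r)"

lemma dsum_eq_0: "int M \<le> s \<Longrightarrow> dsum q M s = 0"
  unfolding dsum_def by (intro sum.neutral) (auto simp: midbin_eq_0)

text \<open>Two relations involve the auxiliary sums \<open>e\<close>: \<open>midbin_ratio\<close>
  summed over \<open>n\<close>, and \<open>midbin_Suc\<close> summed over \<open>n\<close>, which
  telescopes. Eliminating \<open>e\<close> leaves \<open>dsum\<close> alone. For
  \<open>s \<ge> 0\<close> the row \<open>n = 0\<close> contributes nothing at \<open>s + 1\<close>
  and \<open>s + 2\<close>.\<close>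

lemma dsum_recurrence:
  assumes q: "q \<noteq> 0" and s: "s \<ge> 0"
  shows "dsum q M s = q powi (4 * s + 8) * dsum q M (s + 3)
     + q powi s * midbin q M (s + 1) - q powi (3 * s + 4) * midbin q M (s + 2)"
proof -
  define e where "e r = (\<Sum>n<M. q ^ (2 * n + 2) * midbin q n r)" for r
  have ratio: "q\<^sup>2 * (dsum q M r - dsum q M (r + 1)) = q powi (- r) * e r - q powi (r + 2) * e (r + 1)" for r
  proof -
    have "q\<^sup>2 * (q ^ n * midbin q n r - q ^ n * midbin q n (r + 1))
       = q powi (- r) * (q ^ (2 * n + 2) * midbin q n r)
         - q powi (r + 2) * (q ^ (2 * n + 2) * midbin q n (r + 1))" for n
    proof -
      have *: "q ^ n = q powi int n" "q\<^sup>2 = q powi 2" "q ^ (2 * n + 2) = q powi (2 * int n + 2)"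
        using power_int_of_nat[of q "2 * n + 2"] by (simp_all only: of_nat_add of_nat_mult of_nat_numeral power_int_of_nat power_int_numeral)
      have "q powi 2 * (q powi int n * midbin q n r - q powi int n * midbin q n (r + 1))
         - (q powi (- r) * (q powi (2 * int n + 2) * midbin q n r)
           - q powi (r + 2) * (q powi (2 * int n + 2) * midbin q n (r + 1)))
         = q powi (int n + 2) * ((1 - q powi (int n - r)) * midbin q n r
           - (1 - q powi (int n + r + 2)) * midbin q n (r + 1))"
        using q by (simp only: distrib_left distrib_right right_diff_distrib left_diff_distrib mult.assoc
           powi_mult_powi mult_1_left simp_thms)
         (simp add: algebra_simps del: power_int_numeral power_int_of_nat)
      also have "\<dots> = 0" unfolding midbin_ratio[OF q] by simp
      finally show ?thesis unfolding * by simp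
    qed
    then show ?thesis
      unfolding dsum_def e_def sum_distrib_left sum_subtractf[symmetric] by simp
  qed
  have three_term: "midbin q M r - midbin q 0 r
      = q powi (1 - r) * dsum q M (r - 1) + e r + q powi (r + 2) * dsum q M (r + 1)" for r
  proof -
    have "midbin q (Suc n) r - midbin q n r = q powi (1 - r) * (q ^ n * midbin q n (r - 1))
       + q ^ (2 * n + 2) * midbin q n r + q powi (r + 2) * (q ^ n * midbin q n (r + 1))" for n
    proof -
      have *: "q ^ n = q powi int n" "q ^ (2 * n + 2) = q powi (2 * int n + 2)"
        using power_int_of_nat[of q "2 * n + 2"] by (simp_all only: of_nat_add of_nat_mult of_nat_numeral power_int_of_nat power_int_numeral)
      show ?thesis
        unfolding * midbin_Suc[OF q] using q
        by (simp add: powi_mult_powi algebra_simps del: power_int_of_nat)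
    qed
    then have "(\<Sum>n<M. midbin q (Suc n) r - midbin q n r) = q powi (1 - r) * dsum q M (r - 1) + e r
         + q powi (r + 2) * dsum q M (r + 1)"
      by (simp add: dsum_def e_def sum.distrib sum_distrib_left)
    then show ?thesis unfolding sum_lessThan_telescope[of "\<lambda>n. midbin q n r"] .
  qed
  let ?r = "s + 1"
  have e1: "e ?r = midbin q M ?r - q powi (- s) * dsum q M s - q powi (s + 3) * dsum q M (s + 2)"
    using three_term[of ?r] s by (simp add: midbin_0 algebra_simps)
  have e2: "e (?r + 1) = midbin q M (s + 2) - q powi (- 1 - s) * dsum q M (s + 1) - q powi (s + 4) * dsum q M (s + 3)"
    using three_term[of "?r + 1"] s by (simp add: midbin_0 algebra_simps)
  \<comment> \<open>The factor \<open>q powi (2 * s + 1)\<close> normalises the coefficient of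
    \<open>dsum q M s\<close> to 1. After inserting \<open>e1\<close> and \<open>e2\<close> the
    terms at \<open>s + 1\<close> and \<open>s + 2\<close> cancel.\<close>
  have "0 = q powi (2 * s + 1) * (q powi 2 * (dsum q M ?r - dsum q M (?r + 1))
      - (q powi (- ?r) * e ?r - q powi (?r + 2) * e (?r + 1)))"
    using ratio[of ?r] by simp
  also have "\<dots> = dsum q M s - (q powi (4 * s + 8) * dsum q M (s + 3)
     + q powi s * midbin q M (s + 1) - q powi (3 * s + 4) * midbin q M (s + 2))"
    unfolding e1 e2 using q
    by (simp only: distrib_left distrib_right right_diff_distrib left_diff_distrib mult.assoc
           powi_mult_powi mult_1_left simp_thms)
         (simp add: algebra_simps del: power_int_numeral power_int_of_nat)
  finally show ?thesis by simp
qed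

text \<open>The term \<open>n = 0\<close> is 1; each later one is expanded by the finite pentagonal
  theorem. The inner range is \<open>s < M\<close> throughout, with zero binomials for
  \<open>s > n\<close>, so that the two sums can be exchanged.\<close>

lemma H_term_Suc_partial_sum:
  assumes q: "q \<noteq> 0" "\<And>k. 0 < k \<Longrightarrow> k < M \<Longrightarrow> q ^ k \<noteq> 1"
  shows "(\<Sum>n<Suc M. H_term q n) = 1 + q * (\<Sum>s<M. pcoeff q s * dsum q M (int s))"
proof -
  have "(\<Sum>n<Suc M. H_term q n) = 1 + (\<Sum>n<M. H_term q (Suc n))"
    unfolding sum.lessThan_Suc_shift by (simp add: H_term_def qpoch_def)
  also have "(\<Sum>n<M. H_term q (Suc n))
      = (\<Sum>n<M. q ^ Suc n * (\<Sum>s<M. pcoeff q s * midbin q n (int s)))"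
  proof (rule sum.cong[OF refl])
    fix n assume "n \<in> {..<M}"
    then have "(\<Sum>s<M. pcoeff q s * midbin q n (int s)) = qpoch q (q ^ Suc n) (Suc n)"
      using q by (intro finite_pentagonal_nat) auto
    then show "H_term q (Suc n) = q ^ Suc n * (\<Sum>s<M. pcoeff q s * midbin q n (int s))"
      by (simp add: H_term_def)
  qed
  also have "\<dots> = q * (\<Sum>n<M. \<Sum>s<M. pcoeff q s * (q ^ n * midbin q n (int s)))"
    by (simp add: sum_distrib_left algebra_simps)
  also have "\<dots> = q * (\<Sum>s<M. pcoeff q s * dsum q M (int s))"
    by (subst sum.swap) (simp add: dsum_def sum_distrib_left)
  finally show ?thesis .
qed

section \<open>The finite sum at a primitive root of unity\<close>

definition tri :: "int \<Rightarrow> int"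
  where "tri r = r * (r + 1) div 2"

lemma two_tri: "2 * tri r = r * (r + 1)"
  unfolding tri_def by simp

text \<open>Completing the square gives \<open>120 * exp1 m + 1 = (30 * m + 1)^2\<close> and
  \<open>120 * exp2 m + 1 = (30 * m + 11)^2\<close>.\<close>

definition exp1 :: "int \<Rightarrow> int"
  where "exp1 m = (15 * m\<^sup>2 + m) div 2"

definition exp2 :: "int \<Rightarrow> int"
  where "exp2 m = (15 * m\<^sup>2 + 11 * m + 2) div 2"

lemma two_exp1: "2 * exp1 m = 15 * m\<^sup>2 + m"
  unfolding exp1_def by (intro dvd_mult_div_cancel) (auto simp: power2_eq_square)

lemma two_exp2: "2 * exp2 m = 15 * m\<^sup>2 + 11 * m + 2"
  unfolding exp2_def by (intro dvd_mult_div_cancel) (auto simp: power2_eq_square)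

definition false1 :: "complex \<Rightarrow> int \<Rightarrow> complex"
  where "false1 q m = (- 1) powi m * q powi exp1 m"

definition false2 :: "complex \<Rightarrow> int \<Rightarrow> complex"
  where "false2 q m = (- 1) powi m * q powi exp2 m"

lemma minus_one_powi: "(- 1 :: complex) powi i = (if even i then 1 else - 1)"
proof (cases "even i")
  case True
  then obtain k where "i = 2 * k" by auto
  then show ?thesis by (simp add: power_int_mult)
next
  case False
  then obtain k where "i = 2 * k + 1" by (auto elim: oddE)
  then show ?thesis by (simp add: power_int_mult power_int_add)
qed

section \<open>Sums over intervals of integers\<close>

text \<open>A primitive function, so that sums over integer intervals become differences.\<close>

definition isum :: "(int \<Rightarrow> complex) \<Rightarrow> int \<Rightarrow> complex"
  where "isum f n = (if n \<ge> 0 then \<Sum>m\<in>{0..<n}. f m else - (\<Sum>m\<in>{n..<0}. f m))"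

lemma isum_0 [simp]: "isum f 0 = 0"
  by (simp add: isum_def)

lemma isum_Suc: "isum f (n + 1) = isum f n + f n"
proof (cases "n \<ge> 0")
  case True
  then have "{0..<n + 1} = insert n {0..<n}" by auto
  then show ?thesis using True by (simp add: isum_def)
next
  case False
  then have "{n..<0} = insert n {n + 1..<0}" by auto
  then have "(\<Sum>m\<in>{n..<0}. f m) = f n + (\<Sum>m\<in>{n + 1..<0}. f m)" by simp
  moreover have "isum f (n + 1) = - (\<Sum>m\<in>{n + 1..<0}. f m)"
    using False by (cases "n = - 1") (auto simp: isum_def)
  ultimately show ?thesis using False by (simp add: isum_def)
qed

lemma sum_upward: "(\<Sum>k<K. f (a + int k)) = isum f (a + int K) - isum f a"
proof (induction K)
  case (Suc K)
  then show ?case using isum_Suc[of f "a + int K"] by (simp add: algebra_simps)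
qed auto

lemma sum_downward: "(\<Sum>k<K. f (a - int k)) = isum f (a + 1) - isum f (a + 1 - int K)"
proof (induction K)
  case (Suc K)
  then show ?case using isum_Suc[of f "a - int K"] by (simp add: algebra_simps)
qed auto

text \<open>Both sides agree at \<open>n = 0\<close> and have the same increments. It serves for the
  period \<open>N\<close> with factor -1 and, if 3 divides \<open>N\<close>, for
  \<open>N / 3\<close> with a factor involving a cube root of unity.\<close>

lemma isum_quasiperiodic:
  assumes "\<And>m. f (m + p) = c * f m"
  shows "isum f (n + p) = isum f p + c * isum f n"
proof (induction n rule: int_induct[of _ 0])
  case (step1 n)
  then show ?case
    using isum_Suc[of f "n + p"] isum_Suc[of f n] assms[of n] by (simp add: algebra_simps)
next
  case (step2 n)
  then show ?case
    using isum_Suc[of f "n - 1 + p"] isum_Suc[of f "n - 1"] assms[of "n - 1"] by (simp add: algebra_simps)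
qed auto

lemma sum_lessThan_times_3:
  fixes g :: "nat \<Rightarrow> 'a :: comm_monoid_add"
  shows "(\<Sum>j<3 * K. g j) = (\<Sum>k<K. g (3 * k) + g (3 * k + 1) + g (3 * k + 2))"
  by (induction K) (simp_all add: algebra_simps numeral_3_eq_3)

locale primitive_root =
  fixes q :: complex and N :: nat
  assumes N_pos: "N > 0" and root: "q ^ N = 1"
    and primitive: "\<And>k. 0 < k \<Longrightarrow> k < N \<Longrightarrow> q ^ k \<noteq> 1"
begin

section \<open>Reduction of exponents at a primitive root of unity\<close>

lemma nz: "q \<noteq> 0"
  using root N_pos by (auto simp: power_0_left)

lemma powi_N: "q powi (int N * c) = 1"
  using root by (simp add: power_int_mult)

text \<open>The exponents differ by \<open>N * c / 2\<close>. If \<open>N\<close> is even,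
  primitivity forces \<open>q ^ (N div 2) = - 1\<close>; if \<open>N\<close> is odd,
  \<open>c\<close> is even and the power is 1. Doubled exponents suit quadratic forms with
  denominator 2.\<close>

lemma powi_half:
  assumes "2 * e = int N * c + 2 * e'"
  shows "q powi e = (- 1) powi c * q powi e'"
proof (cases "even N")
  case True
  then obtain M where M: "N = 2 * M" by auto
  have "(q ^ M)\<^sup>2 = 1" using root M by (simp add: power_mult [symmetric] mult.commute)
  moreover have "q ^ M \<noteq> 1" using primitive[of M] M N_pos by auto
  ultimately have "q ^ M = - 1" by (simp add: power2_eq_1_iff)
  then have "q powi (int M * c) = (- 1) powi c" by (simp add: power_int_mult)
  moreover have "e = int M * c + e'" using assms M by simp
  ultimately show ?thesis using nz by (simp add: power_int_add)
next
  case False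
  have "int N * c = 2 * (e - e')" using assms by simp
  then have "even (int N * c)" by simp
  then obtain c' where c': "c = 2 * c'" using False by auto
  then have "e = int N * c' + e'" using assms by simp
  then show ?thesis using nz powi_N[of c'] c' by (simp add: power_int_add power_int_mult)
qed

lemma signed_powi_half:
  assumes "2 * e = int N * c + 2 * e'" "odd (i - j + c)"
  shows "(- 1) powi i * q powi e = - ((- 1) powi j * q powi e')"
proof -
  have "(- 1 :: complex) powi i * (- 1) powi c = (- 1) powi (i + c)"
    by (simp add: power_int_add)
  also have "\<dots> = - ((- 1) powi j)"
    using assms(2) by (auto simp: minus_one_powi)
  finally show ?thesis
    using powi_half[OF assms(1)] by (metis mult.assoc mult_minus_left)
qed

text \<open>The doubled exponent grows by \<open>N * c\<close> with
  \<open>c = 30 * m + 15 * N + 1\<close>, and \<open>N + c\<close> is odd.\<close>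

lemma false1_antiperiodic: "false1 q (m + int N) = - false1 q m"
  unfolding false1_def
  by (rule signed_powi_half[where c = "30 * m + 15 * int N + 1"])
     (unfold two_exp1, auto simp: power2_eq_square algebra_simps)

lemma false2_antiperiodic: "false2 q (m + int N) = - false2 q m"
  unfolding false2_def
  by (rule signed_powi_half[where c = "30 * m + 15 * int N + 11"])
     (unfold two_exp2, auto simp: power2_eq_square algebra_simps)

text \<open>Since \<open>q powi (2 * N - 1 - k) = q powi (- (k + 1))\<close>, each ratio in
  \<open>qbinom_ratio\<close> is \<open>- q powi (- (k + 1))\<close>; their product is a signed
  inverse triangular power. The cancelled factor is nonzero because
  \<open>k + 1 < N\<close>.\<close>

lemma qbinom_root:
  assumes "k < N"
  shows "qbinom q (2 * N - 1) (int k) = (- 1) powi int k * q powi (- tri (int k))"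
  using assms
proof (induction k)
  case 0
  then show ?case by (simp add: tri_def)
next
  case (Suc k)
  have "q powi (int k + 1) \<noteq> 1"
    using primitive[of "Suc k"] Suc.prems power_int_of_nat[of q "Suc k"] by (simp add: add.commute)
  moreover have "q powi (int (2 * N - 1) - int k) = q powi (- (int k + 1))"
  proof -
    have "int (2 * N - 1) - int k = int N * 2 + - (int k + 1)" using N_pos by simp
    then show ?thesis using nz powi_N[of 2] by (simp only: power_int_add[OF disjI1[OF nz]]) simp
  qed
  moreover have "1 - q powi (- (int k + 1)) = - (q powi (- (int k + 1))) * (1 - q powi (int k + 1))"
    using powi_mult_powi(1)[OF nz, of "- (int k + 1)" "int k + 1"] by (simp add: algebra_simps)
  ultimately have "(1 - q powi (int k + 1)) * qbinom q (2 * N - 1) (int k + 1)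
      = (1 - q powi (int k + 1)) * (- (q powi (- (int k + 1))) * qbinom q (2 * N - 1) (int k))"
    using qbinom_ratio[OF nz, of "int k" "2 * N - 1"] by (simp only: mult_ac)
  then have "qbinom q (2 * N - 1) (int k + 1) = - (q powi (- (int k + 1))) * qbinom q (2 * N - 1) (int k)"
    using \<open>q powi (int k + 1) \<noteq> 1\<close> mult_left_cancel[of "1 - q powi (int k + 1)"] by (metis right_minus_eq)
  also have "\<dots> = - (q powi (- (int k + 1))) * ((- 1) powi int k * q powi (- tri (int k)))"
    using Suc by simp
  also have "\<dots> = (- 1) powi (int k + 1) * q powi (- tri (int k + 1))"
  proof -
    have "- tri (int k + 1) = - (int k + 1) + - tri (int k)"
      using two_tri[of "int k"] two_tri[of "int k + 1"] by (simp add: algebra_simps)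
    then show ?thesis using nz by (simp only: power_int_add[OF disjI1[OF nz]]) (simp add: power_int_add)
  qed
  finally show ?case by (simp add: add.commute)
qed

text \<open>The row \<open>2 * (N - 1) + 1\<close> is the one of \<open>qbinom_root\<close>; modulo
  \<open>N\<close> its index \<open>N - 1 - r\<close> is traded for \<open>r\<close>.\<close>

lemma midbin_root:
  assumes "0 \<le> r" "r < int N"
  shows "midbin q (N - 1) r = (- 1) powi r * q powi (- tri r)"
proof -
  have "midbin q (N - 1) r = qbinom q (2 * N - 1) (int (N - 1 - nat r))"
  proof -
    have "2 * (N - 1) + 1 = 2 * N - 1" "int (N - 1) - r = int (N - 1 - nat r)"
      using N_pos assms by linarith+
    then show ?thesis unfolding midbin_def by metis
  qed
  also have "\<dots> = (- 1) powi int (N - 1 - nat r) * q powi (- tri (int (N - 1 - nat r)))"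
    by (rule qbinom_root) (use N_pos in simp)
  also have "int (N - 1 - nat r) = int N - 1 - r" using assms by linarith
  also have "(- 1) powi (int N - 1 - r) * q powi (- tri (int N - 1 - r)) = - ((- 1) powi (r - 1) * q powi (- tri r))"
    by (rule signed_powi_half[where c = "2 * r + 1 - int N"])
       (unfold right_diff_distrib mult_minus_right two_tri, auto simp: algebra_simps)
  also have "\<dots> = (- 1) powi r * q powi (- tri r)"
    by (simp add: power_int_diff)
  finally show ?thesis .
qed

section \<open>Solving the recurrence at the root of unity\<close>

text \<open>The deviation of \<^const>\<open>dsum\<close> from the particular solution of its recurrence.\<close>

definition defect :: "int \<Rightarrow> complex"
  where "defect s = dsum q (N - 1) s + (- 1) powi s * q powi (- tri s - 1)"

lemma tri_add: "tri (s + 1) = tri s + s + 1" "tri (s + 2) = tri s + 2 * s + 3"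
    "tri (s + 3) = tri s + 3 * s + 6"
  using two_tri[of s] two_tri[of "s + 1"] two_tri[of "s + 2"] two_tri[of "s + 3"]
  by (simp_all add: algebra_simps)

text \<open>The term added in \<open>defect\<close> is the negative of a particular solution for
  \<open>M = N - 1\<close>, so the inhomogeneity drops out. The bound \<open>s + 2 < N\<close> puts
  both binomials within reach of \<open>midbin_root\<close>.\<close>

lemma defect_recurrence:
  assumes "0 \<le> s" "s + 2 < int N"
  shows "defect s = q powi (4 * s + 8) * defect (s + 3)"
proof -
  have e: "(- 1 :: complex) powi (s + 1) = - ((- 1) powi s)"
     "(- 1 :: complex) powi (s + 2) = (- 1) powi s" "(- 1 :: complex) powi (s + 3) = - ((- 1) powi s)"
    by (simp_all add: power_int_add)
  have m: "midbin q (N - 1) (s + 1) = (- 1) powi (s + 1) * q powi (- tri (s + 1))"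
    "midbin q (N - 1) (s + 2) = (- 1) powi (s + 2) * q powi (- tri (s + 2))"
    by (rule midbin_root; use assms in linarith)+
  show ?thesis
    unfolding defect_def dsum_recurrence[OF nz assms(1)] m tri_add e
    using nz
    by (simp add: powi_mult_powi algebra_simps) (rule arg_cong[where f = "\<lambda>e. q powi e"], simp)
qed

text \<open>Starting values for the descent in steps of 3, one for each residue class. At
  \<open>N - 1\<close> and \<open>N\<close> the sum \<open>dsum q (N - 1)\<close> vanishes; at
  \<open>N - 2\<close> it is a single power, which cancels against the added term.\<close>

lemma defect_top:
  shows "N \<ge> 2 \<Longrightarrow> defect (int N - 2) = 0"
    and "defect (int N - 1) = q powi (- 1)"
    and "defect (int N) = - (q powi (- 1))"
proof -
  have "(- 1) powi (int N - 1) * q powi (- tri (int N - 1) - 1) = - ((- 1) powi 1 * q powi (- 1))"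
    by (rule signed_powi_half[where c = "1 - int N"]) (unfold right_diff_distrib mult_minus_right two_tri, auto simp: algebra_simps)
  then show "defect (int N - 1) = q powi (- 1)"
    using N_pos by (simp add: defect_def dsum_eq_0)
  have "(- 1) powi int N * q powi (- tri (int N) - 1) = - ((- 1) powi 0 * q powi (- 1))"
    by (rule signed_powi_half[where c = "- 1 - int N"]) (unfold right_diff_distrib mult_minus_right two_tri, auto simp: algebra_simps)
  then show "defect (int N) = - (q powi (- 1))"
    using N_pos by (simp add: defect_def dsum_eq_0)
  assume N: "N \<ge> 2"
  have "(- 1) powi (int N - 2) * q powi (- tri (int N - 2) - 1) = - ((- 1) powi 0 * q powi (int N - 2))"
    by (rule signed_powi_half[where c = "1 - int N"]) (unfold right_diff_distrib mult_minus_right two_tri, auto simp: algebra_simps)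
  moreover have "dsum q (N - 1) (int N - 2) = q powi (int N - 2)"
  proof -
    have "midbin q (N - 1) (int N - 1) = 1"
      using N by (simp add: midbin_def)
    moreover have "midbin q (N - 1) (int N) = 0"
      using N by (simp add: midbin_eq_0)
    ultimately show ?thesis
      using dsum_recurrence[OF nz, of "int N - 2" "N - 1"] N by (simp add: dsum_eq_0)
  qed
  ultimately show "defect (int N - 2) = 0"
    by (simp add: defect_def)
qed

lemma defect_0: "N \<ge> 2 + 3 * k \<Longrightarrow> defect (int N - 2 - 3 * int k) = 0"
proof (induction k)
  case (Suc k)
  have "defect (int N - 2 - 3 * int (Suc k))
      = q powi (4 * (int N - 2 - 3 * int (Suc k)) + 8) * defect (int N - 2 - 3 * int (Suc k) + 3)"
    by (rule defect_recurrence) (use Suc in auto)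
  also have "int N - 2 - 3 * int (Suc k) + 3 = int N - 2 - 3 * int k" by simp
  finally show ?case using Suc by simp
qed (simp add: defect_top)

text \<open>The factors \<open>q powi (4 * s + 8)\<close> met on the way down from
  \<open>N - 1\<close> have exponents \<open>4 - 12 * j\<close> modulo \<open>N\<close> for
  \<open>j\<close> from 1 to \<open>k\<close>, which add up to
  \<open>- 6 * k^2 - 2 * k\<close>.\<close>

lemma defect_1:
  "N \<ge> 1 + 3 * k \<Longrightarrow> defect (int N - 1 - 3 * int k) = q powi (- 6 * int k ^ 2 - 2 * int k - 1)"
proof (induction k)
  case (Suc k)
  have "defect (int N - 1 - 3 * int (Suc k))
      = q powi (4 * (int N - 1 - 3 * int (Suc k)) + 8) * defect (int N - 1 - 3 * int (Suc k) + 3)"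
    by (rule defect_recurrence) (use Suc in auto)
  also have "int N - 1 - 3 * int (Suc k) + 3 = int N - 1 - 3 * int k" by simp
  also have "defect (int N - 1 - 3 * int k) = q powi (- 6 * int k ^ 2 - 2 * int k - 1)" using Suc by simp
  also have "4 * (int N - 1 - 3 * int (Suc k)) + 8 = int N * 4 + (- 12 * int k - 8)" by simp
  also have "q powi (int N * 4 + (- 12 * int k - 8)) = q powi (- 12 * int k - 8)"
    unfolding power_int_add[OF disjI1[OF nz]] powi_N by simp
  also have "q powi (- 12 * int k - 8) * q powi (- 6 * int k ^ 2 - 2 * int k - 1)
     = q powi (- 6 * int (Suc k) ^ 2 - 2 * int (Suc k) - 1)"
    unfolding powi_mult_powi(1)[OF nz] by (simp add: power2_eq_square algebra_simps)
  finally show ?case .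
qed (simp add: defect_top)

lemma defect_2:
  "N \<ge> 3 * k \<Longrightarrow> defect (int N - 3 * int k) = - (q powi (- 6 * int k ^ 2 + 2 * int k - 1))"
proof (induction k)
  case (Suc k)
  have "defect (int N - 3 * int (Suc k))
      = q powi (4 * (int N - 3 * int (Suc k)) + 8) * defect (int N - 3 * int (Suc k) + 3)"
    by (rule defect_recurrence) (use Suc in auto)
  also have "int N - 3 * int (Suc k) + 3 = int N - 3 * int k" by simp
  also have "defect (int N - 3 * int k) = - (q powi (- 6 * int k ^ 2 + 2 * int k - 1))" using Suc by simp
  also have "4 * (int N - 3 * int (Suc k)) + 8 = int N * 4 + (- 12 * int k - 4)" by simp
  also have "q powi (int N * 4 + (- 12 * int k - 4)) = q powi (- 12 * int k - 4)"
    unfolding power_int_add[OF disjI1[OF nz]] powi_N by simp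
  also have "q powi (- 12 * int k - 4) * - (q powi (- 6 * int k ^ 2 + 2 * int k - 1))
     = - (q powi (- 6 * int (Suc k) ^ 2 + 2 * int (Suc k) - 1))"
    unfolding mult_minus_right powi_mult_powi(1)[OF nz]
    by (rule arg_cong[where f = "\<lambda>e. - (q powi e)"]) (simp add: power2_eq_square algebra_simps)
  finally show ?case .
qed (simp add: defect_top)

text \<open>Against the pentagonal coefficients the particular solution telescopes, because
  \<open>pent s - tri s = s^2\<close> and \<open>pent (- 1 - s) - tri s = (s + 1)^2\<close>; its
  total is \<open>q - 1\<close>. The remaining sum is reversed so that \<open>j\<close> modulo 3
  selects the closed form of the defect.\<close>

lemma H_root_eq_defect_sum: "H q = q + q * (\<Sum>j<N - 1. pcoeff q (N - 2 - j) * defect (int (N - 2 - j)))"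
proof -
  have "H q = (\<Sum>n<Suc (N - 1). H_term q n)"
    using H_root_of_unity[OF root N_pos] N_pos by simp
  also have "\<dots> = 1 + q * (\<Sum>s<N - 1. pcoeff q s * dsum q (N - 1) (int s))"
    by (rule H_term_Suc_partial_sum[OF nz]) (use primitive in auto)
  also have "q * (\<Sum>s<N - 1. pcoeff q s * dsum q (N - 1) (int s))
      = q * (\<Sum>s<N - 1. pcoeff q s * defect (int s)) + (\<Sum>s<N - 1. q ^ (Suc s)\<^sup>2 - q ^ s\<^sup>2)"
  proof -
    have "q * (pcoeff q s * dsum q (N - 1) (int s))
       = q * (pcoeff q s * defect (int s)) + (q ^ (Suc s)\<^sup>2 - q ^ s\<^sup>2)" for s
    proof -
      let ?s = "int s"
      have sq: "q ^ (Suc s)\<^sup>2 = q powi (?s + 1)\<^sup>2" "q ^ s\<^sup>2 = q powi ?s\<^sup>2"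
        using power_int_of_nat[of q "(Suc s)\<^sup>2"] power_int_of_nat[of q "s\<^sup>2"]
        by (simp_all add: algebra_simps)
      have "q * (pcoeff q s * ((- 1) powi ?s * q powi (- tri ?s - 1)))
          = ((- 1) powi ?s * (- 1) powi ?s) * (q powi 1 * (q powi pent ?s * q powi (- tri ?s - 1)))
          - ((- 1) powi ?s * (- 1) powi ?s) * (q powi 1 * (q powi pent (- 1 - ?s) * q powi (- tri ?s - 1)))"
        unfolding pcoeff_def pterm_def powi_minus_one_reflect by (simp add: algebra_simps)
      also have "(- 1 :: complex) powi ?s * (- 1) powi ?s = 1"
        by (simp add: minus_one_powi)
      also have "q powi 1 * (q powi pent ?s * q powi (- tri ?s - 1)) = q powi ?s\<^sup>2"
        unfolding powi_mult_powi(1)[OF nz]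
        using two_pent[of ?s] two_tri[of ?s] by (intro arg_cong[where f = "\<lambda>e. q powi e"])
          (simp add: algebra_simps power2_eq_square)
      also have "q powi 1 * (q powi pent (- 1 - ?s) * q powi (- tri ?s - 1)) = q powi (?s + 1)\<^sup>2"
        unfolding powi_mult_powi(1)[OF nz] pent_reflect
        using two_pent[of ?s] two_tri[of ?s] by (intro arg_cong[where f = "\<lambda>e. q powi e"])
          (simp add: algebra_simps power2_eq_square)
      finally show ?thesis unfolding defect_def sq by (simp add: algebra_simps)
    qed
    then show ?thesis by (simp add: sum_distrib_left sum.distrib)
  qed
  also have "(\<Sum>s<N - 1. q ^ (Suc s)\<^sup>2 - q ^ s\<^sup>2) = q ^ (N - 1)\<^sup>2 - 1"
    unfolding sum_lessThan_telescope[of "\<lambda>s. q ^ s\<^sup>2"] by simp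
  also have "q ^ (N - 1)\<^sup>2 = q"
  proof -
    have "int (N - 1) = int N - 1" using N_pos by simp
    then have "int ((N - 1)\<^sup>2) = int N * (int N - 2) + 1"
      unfolding of_nat_power by (simp only:) (simp add: power2_eq_square algebra_simps)
    then have "q ^ (N - 1)\<^sup>2 = q powi (int N * (int N - 2) + 1)"
      by (metis power_int_of_nat)
    then show ?thesis using nz by (simp add: power_int_add powi_N)
  qed
  also have "(\<Sum>s<N - 1. pcoeff q s * defect (int s)) = (\<Sum>j<N - 1. pcoeff q (N - 2 - j) * defect (int (N - 2 - j)))"
    using sum.nat_diff_reindex[of "\<lambda>s. pcoeff q s * defect (int s)" "N - 1"]
    by (simp add: numeral_2_eq_2)
  finally show ?thesis by simp
qed

lemma defect_term_0: "3 * k < N - 1 \<Longrightarrow> pcoeff q (N - 2 - 3 * k) * defect (int (N - 2 - 3 * k)) = 0"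
  using defect_0[of k] by (simp add: of_nat_diff algebra_simps)

lemma signed_powi_half':
  assumes "2 * a + 2 * b = int N * c + 2 * e'" "odd (i - j + c)"
  shows "(- 1) powi i * q powi a * q powi b = - ((- 1) powi j * q powi e')"
  using signed_powi_half[of "a + b" c e' i j] assms nz by (simp add: power_int_add mult.assoc)

text \<open>Here \<open>s = N - 3 * K\<close> with \<open>K = k + 1\<close>, so
  \<open>defect_2\<close> applies. Modulo \<open>N\<close> the doubled exponent at \<open>s\<close>
  becomes \<open>27 K^2 - 3 K - 12 K^2 + 4 K = 15 K^2 + K\<close>; the reflected index
  \<open>- 1 - s\<close> gives \<open>exp2 (- K)\<close> in the same way.\<close>

lemma defect_term_1:
  assumes "3 * k + 1 < N - 1"
  shows "q * (pcoeff q (N - 2 - (3 * k + 1)) * defect (int (N - 2 - (3 * k + 1))))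
       = false1 q (int k + 1) - false2 q (- 1 - int k)"
proof -
  let ?s = "int N - 3 * int (Suc k)" and ?e = "- 6 * int (Suc k) ^ 2 + 2 * int (Suc k)"
  have s: "int (N - 2 - (3 * k + 1)) = ?s" using assms by (simp add: of_nat_diff)
  have "q * (pcoeff q (N - 2 - (3 * k + 1)) * defect ?s)
      = - ((- 1) powi ?s * q powi pent ?s * (q powi 1 * q powi (?e - 1)))
        - ((- 1) powi (- 1 - ?s) * q powi pent (- 1 - ?s) * (q powi 1 * q powi (?e - 1)))"
    using assms defect_2[of "Suc k"] unfolding pcoeff_def pterm_def s by (simp add: algebra_simps)
  also have "q powi 1 * q powi (?e - 1) = q powi ?e"
    unfolding powi_mult_powi(1)[OF nz]
    by (rule arg_cong[where f = "\<lambda>e. q powi e"]) (simp add: algebra_simps)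
  also have "(- 1) powi ?s * q powi pent ?s * q powi ?e = - ((- 1) powi (int (Suc k)) * q powi exp1 (int (Suc k)))"
    by (rule signed_powi_half'[where c = "3 * int N - 18 * int (Suc k) + 1"])
       (unfold two_pent two_exp1, auto simp: power2_eq_square algebra_simps)
  also have "(- 1) powi (- 1 - ?s) * q powi pent (- 1 - ?s) * q powi ?e = - ((- 1) powi (- int (Suc k) - 1) * q powi exp2 (- int (Suc k)))"
    by (rule signed_powi_half'[where c = "3 * int N - 18 * int (Suc k) + 5"])
       (unfold two_pent two_exp2, auto simp: power2_eq_square algebra_simps)
  finally show ?thesis
    unfolding s false1_def false2_def by (simp add: algebra_simps minus_one_powi)
qed

text \<open>Now \<open>s = N - 1 - 3 * (k + 1)\<close> and \<open>defect_1\<close> applies; compared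
  with the previous class the two sequences change places.\<close>

lemma defect_term_2:
  assumes "3 * k + 2 < N - 1"
  shows "q * (pcoeff q (N - 2 - (3 * k + 2)) * defect (int (N - 2 - (3 * k + 2))))
       = false2 q (int k + 1) - false1 q (- 1 - int k)"
proof -
  let ?s = "int N - 1 - 3 * int (Suc k)" and ?e = "- 6 * int (Suc k) ^ 2 - 2 * int (Suc k)"
  have s: "int (N - 2 - (3 * k + 2)) = ?s" using assms by (simp add: of_nat_diff)
  have "q * (pcoeff q (N - 2 - (3 * k + 2)) * defect ?s)
      = (- 1) powi ?s * q powi pent ?s * (q powi 1 * q powi (?e - 1))
        + (- 1) powi (- 1 - ?s) * q powi pent (- 1 - ?s) * (q powi 1 * q powi (?e - 1))"
    using assms defect_1[of "Suc k"] unfolding pcoeff_def pterm_def s by (simp add: algebra_simps)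
  also have "q powi 1 * q powi (?e - 1) = q powi ?e"
    unfolding powi_mult_powi(1)[OF nz]
    by (rule arg_cong[where f = "\<lambda>e. q powi e"]) (simp add: algebra_simps)
  also have "(- 1) powi ?s * q powi pent ?s * q powi ?e = - ((- 1) powi (int (Suc k) + 1) * q powi exp2 (int (Suc k)))"
    by (rule signed_powi_half'[where c = "3 * int N - 18 * int (Suc k) - 5"])
       (unfold two_pent two_exp2, auto simp: power2_eq_square algebra_simps)
  also have "(- 1) powi (- 1 - ?s) * q powi pent (- 1 - ?s) * q powi ?e = - ((- 1) powi (- int (Suc k)) * q powi exp1 (- int (Suc k)))"
    by (rule signed_powi_half'[where c = "3 * int N - 18 * int (Suc k) - 1"])
       (unfold two_pent two_exp1, auto simp: power2_eq_square algebra_simps)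
  finally show ?thesis
    unfolding s false1_def false2_def by (simp add: algebra_simps minus_one_powi)
qed

text \<open>The defect terms run over about a third of a period on either side of 0. For
  \<open>N\<close> prime to 3 one sequence is a translate of the other; for \<open>N\<close>
  divisible by 3 a shift by \<open>N / 3\<close> multiplies each by a constant. Either relation,
  together with antiperiodicity, completes the sum to a full period.\<close>

lemma H_root_eq_sum_false: "2 * H q = isum (false1 q) (int N) + isum (false2 q) (int N)"
proof -
  define g where "g j = q * (pcoeff q (N - 2 - j) * defect (int (N - 2 - j)))" for j
  have H: "H q = false2 q 0 + (\<Sum>j<N - 1. g j)"
    unfolding H_root_eq_defect_sum g_def sum_distrib_left by (simp add: false2_def exp2_def)
  have g0: "g (3 * k) = 0" if "3 * k < N - 1" for k
    unfolding g_def using defect_term_0[OF that] by simp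
  have g1: "g (3 * k + 1) = false1 q (1 + int k) - false2 q (- 1 - int k)" if "3 * k + 1 < N - 1" for k
    unfolding g_def using defect_term_1[OF that] by (simp add: add.commute)
  have g2: "g (3 * k + 2) = false2 q (1 + int k) - false1 q (- 1 - int k)" if "3 * k + 2 < N - 1" for k
    unfolding g_def using defect_term_2[OF that] by (simp add: add.commute)
  let ?A = "isum (false1 q)" and ?B = "isum (false2 q)"
  have blocks: "(\<Sum>j<3 * K. g j) = ?A (1 + int K) - ?A 1 + ?A (- int K) - (?B 0 - ?B (- int K)) + (?B (1 + int K) - ?B 1)"
    if "3 * K \<le> N - 1" for K
  proof -
    have "(\<Sum>j<3 * K. g j) = (\<Sum>k<K. (false1 q (1 + int k) - false2 q (- 1 - int k)) + (false2 q (1 + int k) - false1 q (- 1 - int k)))"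
      unfolding sum_lessThan_times_3
    proof (rule sum.cong[OF refl])
      fix k assume "k \<in> {..<K}"
      with that show "g (3 * k) + g (3 * k + 1) + g (3 * k + 2) = (false1 q (1 + int k) - false2 q (- 1 - int k)) + (false2 q (1 + int k) - false1 q (- 1 - int k))"
        using g0[of k] g1[of k] g2[of k] by simp
    qed
    then show ?thesis
      by (simp add: sum.distrib sum_subtractf sum_upward sum_downward)
  qed
  have A_shift: "?A (n + int N) = ?A (int N) - ?A n" for n
    using isum_quasiperiodic[of "false1 q" "int N" "- 1" n] false1_antiperiodic by simp
  have B_shift: "?B (n + int N) = ?B (int N) - ?B n" for n
    using isum_quasiperiodic[of "false2 q" "int N" "- 1" n] false2_antiperiodic by simp
  have B0: "false2 q 0 = ?B 1" using isum_Suc[of "false2 q" 0] by simp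
  consider K where "N = 3 * K + 1" | K where "N = 3 * K + 2" | K where "N = 3 * K + 3"
  proof -
    have "N = 3 * ((N - 1) div 3) + 1 \<or> N = 3 * ((N - 1) div 3) + 2 \<or> N = 3 * ((N - 1) div 3) + 3"
      using N_pos by presburger
    then show ?thesis using that by blast
  qed
  \<comment> \<open>With exponents written as \<open>(n^2 - 1)/120\<close>, the relations \<open>f\<close> between the two sequences
      come from \<open>n \<mapsto> 20 N - n\<close>; for \<open>3 dvd N\<close> one uses \<open>n \<mapsto> n + 10 N\<close> instead.\<close>
  then show ?thesis
  proof cases
    case 1
    have f: "false2 q m = false1 q (m - int K)" for m
    proof -
      have "2 * exp2 m = int N * (10 * m + 2 - 5 * int K) + 2 * exp1 (m - int K)"
        unfolding two_exp1 two_exp2 using 1 by (simp add: power2_eq_square algebra_simps)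
      from powi_half[OF this] show ?thesis
        by (simp add: false1_def false2_def minus_one_powi)
    qed
    have B: "?B n = ?A (n - int K) - ?A (- int K)" for n
    proof (induction n rule: int_induct[of _ 0])
      case (step1 n)
      then show ?case using isum_Suc[of "false2 q" n] isum_Suc[of "false1 q" "n - int K"] f[of n]
        by (simp add: algebra_simps)
    next
      case (step2 n)
      then show ?case using isum_Suc[of "false2 q" "n - 1"] isum_Suc[of "false1 q" "n - 1 - int K"] f[of "n - 1"]
        by (simp add: algebra_simps)
    qed simp
    \<comment> \<open>Antiperiodicity with \<open>N = 3 * K + 1\<close> brings the negative
      endpoints back into the period.\<close>
    have e: "?A (- (2 * int K)) = ?A (3 * int K + 1) - ?A (1 + int K)" "?A (- int K) = ?A (int N) - ?A (2 * int K + 1)"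
      using A_shift[of "- int K - int K"] A_shift[of "- int K"] 1 by (simp_all add: add.commute)
    have "N - 1 = 3 * K" "int N - int K = 2 * int K + 1" using 1 by simp_all
    then show ?thesis
      unfolding H B0 using blocks[of K] by (simp add: B e)
  next
    case 2
    have f: "false2 q m = false1 q (m + (int K + 1))" for m
    proof -
      have "2 * exp1 (m + (int K + 1)) = int N * (10 * m + 5 * int K + 7) + 2 * exp2 m"
        unfolding two_exp1 two_exp2 using 2 by (simp add: power2_eq_square algebra_simps)
      from powi_half[OF this] show ?thesis
        by (simp add: false1_def false2_def minus_one_powi)
    qed
    have B: "?B n = ?A (n + (int K + 1)) - ?A (int K + 1)" for n
    proof (induction n rule: int_induct[of _ 0])
      case (step1 n)
      then show ?case using isum_Suc[of "false2 q" n] isum_Suc[of "false1 q" "n + (int K + 1)"] f[of n]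
        by (simp add: algebra_simps)
    next
      case (step2 n)
      then show ?case using isum_Suc[of "false2 q" "n - 1"] isum_Suc[of "false1 q" "n - 1 + (int K + 1)"] f[of "n - 1"]
        by (simp add: algebra_simps)
    qed simp
    have "g (3 * K) = 0" using g0 2 by simp
    moreover have "N - 1 = Suc (3 * K)" using 2 by simp
    moreover have "?A (- int K) = ?A (int N) - ?A (2 * int K + 2)"
      using A_shift[of "- int K"] 2 by simp
    moreover have "?A (int N + (int K + 1)) = ?A (int N) - ?A (int K + 1)"
      using A_shift[of "int K + 1"] by (simp add: add.commute)
    ultimately show ?thesis
      unfolding H B0 using blocks[of K] 2 by (simp add: B algebra_simps)
  next
    case 3
    \<comment> \<open>As \<open>N = 3 * (K + 1)\<close>, this is a primitive cube root of unity; a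
      shift by a third of the period multiplies the two sequences by \<open>- w^2\<close> and
      \<open>- w\<close>.\<close>
    define w where "w = q ^ (K + 1)"
    have "w ^ 3 = 1"
      unfolding w_def power_mult[symmetric] using 3 root by (simp add: algebra_simps)
    moreover have "w \<noteq> 1" unfolding w_def using primitive[of "K + 1"] 3 by simp
    moreover have "w ^ 3 - 1 = (w - 1) * (w\<^sup>2 + w + 1)"
      by (simp add: power3_eq_cube power2_eq_square algebra_simps)
    ultimately have w: "w\<^sup>2 + w + 1 = 0" by simp
    have wp1: "w = q powi (int K + 1)"
      using power_int_of_nat[of q "K + 1"] by (simp add: w_def add.commute)
    have wp2: "w\<^sup>2 = q powi (2 * (int K + 1))"
      unfolding wp1 power_int_power' by (simp add: mult.commute)
    have f1: "false1 q (m + (int K + 1)) = - w\<^sup>2 * false1 q m" for m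
    proof -
      have "2 * exp1 (m + (int K + 1)) = int N * (10 * m + 5 * (int K + 1) - 1) + 2 * (exp1 m + 2 * (int K + 1))"
        unfolding two_exp1 distrib_left using 3 by (simp add: power2_eq_square algebra_simps)
      from powi_half[OF this] show ?thesis
        unfolding false1_def wp2 power_int_add[OF disjI1[OF nz], of "exp1 m" "2 * (int K + 1)"]
        by (simp add: minus_one_powi)
    qed
    have f2: "false2 q (m + (int K + 1)) = - w * false2 q m" for m
    proof -
      have "2 * exp2 (m + (int K + 1)) = int N * (10 * m + 5 * (int K + 1) + 3) + 2 * (exp2 m + (int K + 1))"
        unfolding two_exp2 distrib_left using 3 by (simp add: power2_eq_square algebra_simps)
      from powi_half[OF this] show ?thesis
        unfolding false2_def wp1 power_int_add[OF disjI1[OF nz], of "exp2 m" "int K + 1"]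
        by (simp add: minus_one_powi)
    qed
    let ?a = "?A (int K + 1)" and ?b = "?B (int K + 1)"
    have As: "?A (n + (int K + 1)) = ?a - w\<^sup>2 * ?A n" for n
      using isum_quasiperiodic[of "false1 q" "int K + 1" "- w\<^sup>2" n] f1 by simp
    have Bs: "?B (n + (int K + 1)) = ?b - w * ?B n" for n
      using isum_quasiperiodic[of "false2 q" "int K + 1" "- w" n] f2 by simp
    \<comment> \<open>\<open>N - 1 = 3 * K + 2\<close> leaves an incomplete block: its first term
      vanishes and its second is a single pair.\<close>
    have g_last: "g (3 * K) = 0" "g (Suc (3 * K)) = ?A (int K + 2) - ?a - (?B (- int K) - ?B (- 1 - int K))"
      using g0[of K] g1[of K] 3 isum_Suc[of "false1 q" "int K + 1"] isum_Suc[of "false2 q" "- 1 - int K"]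
      by (simp_all add: algebra_simps)
    have N1: "N - 1 = Suc (Suc (3 * K))" using 3 by simp
    have H': "H q = ?a - ?A 1 + ?A (- int K) + ?b + (?A (int K + 2) - ?a) + ?B (- 1 - int K)"
      unfolding H B0 N1 sum.lessThan_Suc g_last using blocks[of K] 3 by (simp add: add.commute)
    have 1: "?A (int K + 2) = ?a - w\<^sup>2 * ?A 1" using As[of 1] by (simp add: algebra_simps)
    have 2: "?A 1 = ?a - w\<^sup>2 * ?A (- int K)" using As[of "- int K"] by simp
    have 4: "0 = ?b - w * ?B (- 1 - int K)" using Bs[of "- 1 - int K"] by simp
    have N3: "int N = int K + 1 + (int K + 1) + (int K + 1)" using 3 by simp
    have 5: "?A (int N) = ?a - w\<^sup>2 * (?a - w\<^sup>2 * ?a)"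
      unfolding N3 As ..
    have 6: "?B (int N) = ?b - w * (?b - w * ?b)"
      unfolding N3 Bs ..
    show ?thesis
      unfolding H' 5 6 1 using 2 4 w by algebra
  qed
qed

end

section \<open>The unit disc: passage to the limit\<close>

definition euler_prod :: "complex \<Rightarrow> complex"
  where "euler_prod q = (\<Prod>n. 1 - q ^ Suc n)"

text \<open>Summands of the partial theta series found by iterating the limiting recurrence; each
  application contributes two consecutive values of \<open>b\<close>.\<close>

definition ptheta_term :: "complex \<Rightarrow> nat \<Rightarrow> nat \<Rightarrow> complex"
  where "ptheta_term q s b = (- 1) ^ b * q powi (pent (int b) + 2 * int b + 2 * int s * int b + int s)"

section \<open>Product formulas and convergence in the disc\<close>

lemma qpoch_add: "qpoch q x (n + m) = qpoch q x n * qpoch q (x * q ^ n) m"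
  by (induction m) (simp_all add: qpoch_def power_add mult_ac)

lemma qbinom_qpoch:
  assumes q: "q \<noteq> 0" "\<And>k. q ^ Suc k \<noteq> 1" and "k \<le> n"
  shows "qbinom q n (int k) * (qpoch q q k * qpoch q q (n - k)) = qpoch q q n"
  using assms(3)
proof (induction k)
  case (Suc k)
  have e1: "qpoch q q (n - k) = qpoch q q (n - Suc k) * (1 - q powi (int n - int k))"
  proof -
    have "n - k = Suc (n - Suc k)" using Suc.prems by simp
    then have "qpoch q q (n - k) = qpoch q q (n - Suc k) * (1 - q ^ (n - k))"
      by (simp add: qpoch_def)
    moreover have "q ^ (n - k) = q powi (int n - int k)"
      using Suc.prems by (metis Suc_leD of_nat_diff power_int_of_nat)
    ultimately show ?thesis by simp
  qed
  have "qpoch q q (Suc k) = qpoch q q k * (1 - q powi (int k + 1))"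
    using q(1) by (simp add: qpoch_def power_int_add)
  then have "qbinom q n (int (Suc k)) * (qpoch q q (Suc k) * qpoch q q (n - Suc k))
     = ((1 - q powi (int k + 1)) * qbinom q n (int k + 1)) * (qpoch q q k * qpoch q q (n - Suc k))"
    by (simp add: mult_ac add.commute)
  also have "\<dots> = qbinom q n (int k) * (qpoch q q k * (qpoch q q (n - Suc k) * (1 - q powi (int n - int k))))"
    unfolding qbinom_ratio[OF q(1)] by (simp only: mult_ac)
  also have "qpoch q q (n - Suc k) * (1 - q powi (int n - int k)) = qpoch q q (n - k)"
    by (rule e1[symmetric])
  finally show ?case using Suc by simp
qed (simp add: qpoch_def)

locale unit_disc =
  fixes q :: complex
  assumes nz: "q \<noteq> 0" and lt1: "norm q < 1"
begin

lemma power_ne_1: "q ^ Suc k \<noteq> 1"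
proof
  assume "q ^ Suc k = 1"
  then have "norm q ^ Suc k = 1" by (metis norm_one norm_power)
  moreover have "norm q ^ Suc k < 1" using power_Suc_less_one[of "norm q" k] lt1 nz by simp
  ultimately show False by simp
qed

lemma norm_powi_le:
  assumes "int n \<le> e"
  shows "norm (q powi e) \<le> norm q ^ n"
proof -
  have "norm q powi e \<le> norm q powi int n"
    using assms lt1 nz by (intro power_int_decreasing) auto
  then show ?thesis by (simp add: norm_power_int)
qed

lemma summable_geom: "summable (\<lambda>n. norm q ^ n)"
  using lt1 by (simp add: summable_geometric)

lemma summable_norm_powers: "summable (\<lambda>n. norm (q ^ Suc n))"
  using summable_mult[OF summable_geom, of "norm q"] by (simp add: norm_power norm_mult)

lemma qpoch_tendsto: "qpoch q q \<longlonglongrightarrow> euler_prod q" and euler_prod_nz: "euler_prod q \<noteq> 0"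
proof -
  have c: "convergent_prod (\<lambda>n. 1 - q ^ Suc n)"
    using summable_norm_powers
    by (intro abs_convergent_prod_imp_convergent_prod summable_imp_abs_convergent_prod) simp
  have "(\<lambda>n. qpoch q q (Suc n)) \<longlonglongrightarrow> euler_prod q"
    using convergent_prod_LIMSEQ[OF c] by (simp add: euler_prod_def qpoch_def lessThan_Suc_atMost)
  then show "qpoch q q \<longlonglongrightarrow> euler_prod q" by (rule LIMSEQ_imp_Suc)
  show "euler_prod q \<noteq> 0"
    unfolding euler_prod_def by (rule prodinf_nonzero[OF c]) (use power_ne_1 in auto)
qed

lemma qpoch_nz: "qpoch q q n \<noteq> 0"
  unfolding qpoch_def using power_ne_1 by (auto simp: power_Suc[symmetric] simp del: power_Suc)

lemma qbinom_eq: "k \<le> n \<Longrightarrow> qbinom q n (int k) = qpoch q q n / (qpoch q q k * qpoch q q (n - k))"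
  using qbinom_qpoch[OF nz power_ne_1, of k n] qpoch_nz by (simp add: field_simps)

text \<open>\<open>qpoch q q\<close> converges to a nonzero limit, so it and its inverse are
  bounded. Uniformity in both indices provides the domination for Tannery's theorem.\<close>

lemma qbinom_bounded: "\<exists>C>0. \<forall>n k. norm (qbinom q n k) \<le> C"
proof -
  obtain A where A: "A > 0" "\<And>n. norm (qpoch q q n) \<le> A"
    using convergent_imp_Bseq[OF convergentI[OF qpoch_tendsto]] by (auto elim!: BseqE)
  obtain B where B: "B > 0" "\<And>n. norm (inverse (qpoch q q n)) \<le> B"
    using convergent_imp_Bseq[OF convergentI[OF tendsto_inverse[OF qpoch_tendsto euler_prod_nz]]]
    by (auto elim!: BseqE)
  have "norm (qbinom q n k) \<le> A * (B * B)" for n k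
  proof (cases "0 \<le> k \<and> k \<le> int n")
    case True
    then obtain j where j: "k = int j" "j \<le> n" by (metis nat_0_le of_nat_le_iff)
    have "norm (qbinom q n k) = norm (qpoch q q n) * (norm (inverse (qpoch q q j)) * norm (inverse (qpoch q q (n - j))))"
      unfolding j(1) qbinom_eq[OF j(2)] by (simp add: norm_mult norm_divide norm_inverse divide_simps)
    also have "\<dots> \<le> A * (B * B)"
      using A B by (intro mult_mono) (auto intro: less_imp_le)
    finally show ?thesis .
  next
    case False
    then show ?thesis using A(1) B(1) by (subst qbinom_eq_0) auto
  qed
  then show ?thesis using A(1) B(1) by (intro exI[of _ "A * (B * B)"]) auto
qed

lemma midbin_bounded: "\<exists>C>0. \<forall>n r. norm (midbin q n r) \<le> C"
  using qbinom_bounded unfolding midbin_def by blast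

lemma midbin_tendsto: "(\<lambda>n. midbin q n (int s)) \<longlonglongrightarrow> 1 / euler_prod q"
proof -
  have "(\<lambda>n. qpoch q q (2 * n + 1) / (qpoch q q (n - s) * qpoch q q (n + 1 + s)))
     \<longlonglongrightarrow> euler_prod q / (euler_prod q * euler_prod q)"
  proof (intro tendsto_intros)
    show "(\<lambda>n. qpoch q q (2 * n + 1)) \<longlonglongrightarrow> euler_prod q"
      by (rule filterlim_compose[OF qpoch_tendsto]) real_asymp
    show "(\<lambda>n. qpoch q q (n - s)) \<longlonglongrightarrow> euler_prod q"
      by (rule filterlim_compose[OF qpoch_tendsto filterlim_minus_const_nat_at_top])
    show "(\<lambda>n. qpoch q q (n + 1 + s)) \<longlonglongrightarrow> euler_prod q"
      using LIMSEQ_ignore_initial_segment[OF qpoch_tendsto, of "1 + s"] by (simp add: add_ac)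
  qed (use euler_prod_nz in auto)
  moreover have "\<forall>\<^sub>F n in sequentially. qpoch q q (2 * n + 1) / (qpoch q q (n - s) * qpoch q q (n + 1 + s)) = midbin q n (int s)"
    using eventually_ge_at_top[of s]
  proof eventually_elim
    case (elim n)
    have "2 * n + 1 - (n - s) = n + 1 + s" using elim by simp
    moreover have "int n - int s = int (n - s)" using elim by simp
    ultimately show ?case unfolding midbin_def using qbinom_eq[of "n - s" "2 * n + 1"] elim by simp
  qed
  ultimately have "(\<lambda>n. midbin q n (int s)) \<longlonglongrightarrow> euler_prod q / (euler_prod q * euler_prod q)"
    by (rule Lim_transform_eventually)
  then show ?thesis using euler_prod_nz by simp
qed

lemma pent_ge: "int s \<le> pent (int s)" "int s \<le> pent (- 1 - int s)"
proof -
  have "int s * (3 * int s + 1) \<ge> int s * 2" by (cases "s = 0") auto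
  then show "int s \<le> pent (int s)" using two_pent[of "int s"] by linarith
  then show "int s \<le> pent (- 1 - int s)" unfolding pent_reflect by simp
qed

lemma norm_pterm: "norm (pterm q r) = norm (q powi pent r)"
  by (simp add: pterm_def norm_mult norm_power_int)

lemma norm_pcoeff_le: "norm (pcoeff q s) \<le> 2 * norm q ^ s"
  using norm_triangle_ineq[of "pterm q (int s)" "pterm q (- 1 - int s)"]
    norm_powi_le[OF pent_ge(1)[of s]] norm_powi_le[OF pent_ge(2)[of s]]
  by (simp add: pcoeff_def norm_pterm)

text \<open>Euler's pentagonal number theorem as a limit of \<open>finite_pentagonal_nat\<close>:
  the right side is \<open>qpoch q q (2 * n + 1) / qpoch q q n\<close> and tends to 1, while each
  binomial on the left tends to \<open>1 / euler_prod q\<close>.\<close>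

lemma pentagonal: "pcoeff q sums euler_prod q"
proof -
  obtain C where C: "C > 0" "\<And>n r. norm (midbin q n r) \<le> C" using midbin_bounded by auto
  define a where "a s n = pcoeff q s * midbin q n (int s)" for s n
  have T: "(\<forall>\<^sub>F n in sequentially. summable (\<lambda>k. norm (a k n))) \<and> summable (\<lambda>s. norm (pcoeff q s * (1 / euler_prod q)))
      \<and> (\<lambda>n. \<Sum>s. a s n) \<longlonglongrightarrow> (\<Sum>s. pcoeff q s * (1 / euler_prod q))"
  proof (rule tannerys_theorem)
    show "(\<lambda>n. a s n) \<longlonglongrightarrow> pcoeff q s * (1 / euler_prod q)" for s
      unfolding a_def by (intro tendsto_intros midbin_tendsto)
    show "\<forall>\<^sub>F (s, n) in sequentially \<times>\<^sub>F sequentially. norm (a s n) \<le> (2 * C) * norm q ^ s"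
    proof (intro always_eventually, safe)
      fix s n
      have "norm (a s n) \<le> (2 * norm q ^ s) * C"
        unfolding a_def norm_mult using C by (intro mult_mono norm_pcoeff_le) (auto intro: less_imp_le)
      then show "norm (a s n) \<le> (2 * C) * norm q ^ s" by (simp add: mult_ac)
    qed
    show "summable (\<lambda>s. (2 * C) * norm q ^ s)" by (intro summable_mult summable_geom)
  qed auto
  have fin: "(\<Sum>s. a s n) = qpoch q q (2 * n + 1) / qpoch q q n" for n
  proof -
    have "(\<Sum>s. a s n) = (\<Sum>s<Suc n. a s n)"
      by (rule suminf_finite) (auto simp: a_def midbin_eq_0)
    also have "\<dots> = qpoch q (q ^ Suc n) (Suc n)"
      unfolding a_def by (rule finite_pentagonal_nat[OF nz]) (use power_ne_1 in \<open>auto simp: gr0_conv_Suc\<close>)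
    finally have *: "(\<Sum>s. a s n) = qpoch q (q ^ Suc n) (Suc n)" .
    have "qpoch q q n * qpoch q (q ^ Suc n) (Suc n) = qpoch q q (n + Suc n)"
      unfolding qpoch_add by simp
    also have "n + Suc n = 2 * n + 1" by simp
    finally have "qpoch q (q ^ Suc n) (Suc n) = qpoch q q (2 * n + 1) / qpoch q q n"
      using qpoch_nz[of n] by (simp add: field_simps)
    with * show ?thesis by simp
  qed
  have "(\<lambda>n. \<Sum>s. a s n) \<longlonglongrightarrow> euler_prod q / euler_prod q"
    unfolding fin
  proof (intro tendsto_intros)
    show "(\<lambda>n. qpoch q q (2 * n + 1)) \<longlonglongrightarrow> euler_prod q"
      by (rule filterlim_compose[OF qpoch_tendsto]) real_asymp
  qed (use euler_prod_nz qpoch_tendsto in auto)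
  then have "(\<Sum>s. pcoeff q s * (1 / euler_prod q)) = 1"
    using T LIMSEQ_unique euler_prod_nz by fastforce
  then have "(\<lambda>s. pcoeff q s * (1 / euler_prod q)) sums 1"
    using T summable_norm_cancel summable_sums by metis
  from sums_mult2[OF this, of "euler_prod q"] show ?thesis
    using euler_prod_nz by simp
qed

section \<open>Limits of the auxiliary sums and the partial theta series\<close>

definition dlim :: "nat \<Rightarrow> complex"
  where "dlim s = (\<Sum>n. q ^ n * midbin q n (int s))"

text \<open>A geometric series dominates all sums. Uniformity in \<open>s\<close> serves the limit
  of the outer sum and the uniqueness argument for the recurrence.\<close>

lemma dlim_bounds:
  "\<exists>C. (\<forall>M s. norm (dsum q M (int s)) \<le> C) \<and> (\<forall>s. norm (dlim s) \<le> C)"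
  and dsum_tendsto: "(\<lambda>M. dsum q M (int s)) \<longlonglongrightarrow> dlim s"
proof -
  obtain C where C: "C > 0" "\<And>n r. norm (midbin q n r) \<le> C" using midbin_bounded by auto
  have tb: "norm (q ^ n * midbin q n r) \<le> C * norm q ^ n" for n r
    using mult_left_mono[OF C(2)[of n r], of "norm q ^ n"] by (simp add: norm_mult norm_power mult_ac)
  have summ: "summable (\<lambda>n. C * norm q ^ n)" by (intro summable_mult summable_geom)
  have lim: "(\<lambda>M. dsum q M (int s)) \<longlonglongrightarrow> dlim s" for s
  proof -
    have "summable (\<lambda>n. q ^ n * midbin q n (int s))"
      using tb by (intro summable_comparison_test'[OF summ, of 0]) auto
    then show ?thesis unfolding dsum_def dlim_def by (rule summable_LIMSEQ)
  qed
  then show "(\<lambda>M. dsum q M (int s)) \<longlonglongrightarrow> dlim s" .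
  have b: "norm (dsum q M (int s)) \<le> (\<Sum>n. C * norm q ^ n)" for M s
  proof -
    have "norm (dsum q M (int s)) \<le> (\<Sum>n<M. C * norm q ^ n)"
      unfolding dsum_def by (rule sum_norm_le) (rule tb)
    also have "\<dots> \<le> (\<Sum>n. C * norm q ^ n)"
      using C(1) by (intro sum_le_suminf summ) auto
    finally show ?thesis .
  qed
  moreover have "norm (dlim s) \<le> (\<Sum>n. C * norm q ^ n)" for s
    by (rule LIMSEQ_le_const2[OF tendsto_norm[OF lim]]) (use b in auto)
  ultimately show "\<exists>C. (\<forall>M s. norm (dsum q M (int s)) \<le> C) \<and> (\<forall>s. norm (dlim s) \<le> C)" by blast
qed

text \<open>\<open>H_term_Suc_partial_sum\<close> for \<open>M \<rightarrow> \<infinity>\<close>,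
  exchanged with the outer sum by Tannery's theorem; the pentagonal coefficients supply the summable
  majorant.\<close>

lemma H_eq_dlim: "(\<lambda>s. q * (pcoeff q s * dlim s)) sums (H q - 1)"
proof -
  obtain C where C: "\<And>M s. norm (dsum q M (int s)) \<le> C" using dlim_bounds by auto
  then have C0: "C \<ge> 0" using norm_ge_zero order_trans by blast
  define a where "a s M = q * (pcoeff q s * dsum q M (int s))" for s M
  have T: "(\<forall>\<^sub>F n in sequentially. summable (\<lambda>k. norm (a k n))) \<and> summable (\<lambda>s. norm (q * (pcoeff q s * dlim s)))
      \<and> (\<lambda>n. \<Sum>s. a s n) \<longlonglongrightarrow> (\<Sum>s. q * (pcoeff q s * dlim s))"
  proof (rule tannerys_theorem)
    show "(\<lambda>n. a s n) \<longlonglongrightarrow> q * (pcoeff q s * dlim s)" for s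
      unfolding a_def by (intro tendsto_intros dsum_tendsto)
    show "\<forall>\<^sub>F (s, n) in sequentially \<times>\<^sub>F sequentially. norm (a s n) \<le> (2 * C) * norm q ^ s"
    proof (intro always_eventually, safe)
      fix s n
      have "norm (a s n) \<le> 1 * ((2 * norm q ^ s) * C)"
        unfolding a_def norm_mult using C C0 lt1 by (intro mult_mono norm_pcoeff_le) auto
      then show "norm (a s n) \<le> (2 * C) * norm q ^ s" by (simp add: mult_ac)
    qed
    show "summable (\<lambda>s. (2 * C) * norm q ^ s)" by (intro summable_mult summable_geom)
  qed auto
  have "(\<Sum>s. a s M) = (\<Sum>n<Suc M. H_term q n) - 1" for M
  proof -
    have "(\<Sum>s. a s M) = (\<Sum>s<M. a s M)"
      by (rule suminf_finite) (auto simp: a_def dsum_eq_0)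
    also have "\<dots> = (\<Sum>n<Suc M. H_term q n) - 1"
    proof -
      have "(\<Sum>n<Suc M. H_term q n) = 1 + q * (\<Sum>s<M. pcoeff q s * dsum q M (int s))"
        by (rule H_term_Suc_partial_sum[OF nz]) (use power_ne_1 in \<open>auto simp: gr0_conv_Suc\<close>)
      then show ?thesis by (simp add: a_def sum_distrib_left)
    qed
    finally show ?thesis .
  qed
  moreover have "(\<lambda>M. (\<Sum>n<Suc M. H_term q n) - 1) \<longlonglongrightarrow> H q - 1"
    unfolding H_def using summable_norm_cancel[OF summable_H_term[OF lt1]]
    by (intro tendsto_intros LIMSEQ_Suc summable_LIMSEQ)
  ultimately have "(\<Sum>s. q * (pcoeff q s * dlim s)) = H q - 1"
    using T LIMSEQ_unique by fastforce
  then show ?thesis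
    using T summable_norm_cancel summable_sums by metis
qed

lemma norm_ptheta_term_le: "norm (ptheta_term q s b) \<le> norm q ^ b"
proof -
  have "int b \<le> pent (int b) + 2 * int b + 2 * int s * int b + int s"
    using pent_ge(1)[of b] by (auto intro!: add_nonneg_nonneg add_increasing2)
  from norm_powi_le[OF this] show ?thesis
    by (simp add: ptheta_term_def norm_mult norm_power)
qed

lemma summable_ptheta_term: "summable (ptheta_term q s)"
  by (rule summable_comparison_test'[OF summable_geom, of 0]) (rule norm_ptheta_term_le)

text \<open>Replacing \<open>b\<close> by \<open>b + 2\<close> amounts to replacing \<open>s\<close>
  by \<open>s + 3\<close>, up to a power of \<open>q\<close>; the first two terms form the
  inhomogeneity.\<close>

lemma ptheta_recurrence:
  "(\<Sum>b. ptheta_term q s b) = q powi (4 * int s + 8) * (\<Sum>b. ptheta_term q (s + 3) b)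
     + q powi int s - q powi (3 * int s + 4)"
proof -
  have "ptheta_term q s (b + 2) = q powi (4 * int s + 8) * ptheta_term q (s + 3) b" for b
  proof -
    have "pent (int (b + 2)) = pent (int b) + 6 * int b + 7"
      using pent_Suc[of "int b"] pent_Suc[of "int b + 1"] by simp
    then have "pent (int (b + 2)) + 2 * int (b + 2) + 2 * int s * int (b + 2) + int s
       = 4 * int s + 8 + (pent (int b) + 2 * int b + 2 * int (s + 3) * int b + int (s + 3))"
      by (simp add: algebra_simps)
    then show ?thesis unfolding ptheta_term_def
      by (simp only: power_int_add[OF disjI1[OF nz], of "4 * int s + 8"]) simp
  qed
  then have "(\<Sum>b. ptheta_term q s (b + 2)) = q powi (4 * int s + 8) * (\<Sum>b. ptheta_term q (s + 3) b)"
    by (simp add: suminf_mult[OF summable_ptheta_term])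
  moreover have "(\<Sum>b<2. ptheta_term q s b) = q powi int s - q powi (3 * int s + 4)"
    by (simp add: ptheta_term_def pent_def numeral_2_eq_2)
  ultimately show ?thesis
    using suminf_split_initial_segment[OF summable_ptheta_term, of s 2] by simp
qed

text \<open>Both sides satisfy the same inhomogeneous recurrence. Their difference satisfies the
  homogeneous one and is bounded uniformly in \<open>s\<close>; each step contributes a factor of
  norm at most \<open>norm q\<close>, so iteration forces it to be 0.\<close>

lemma dlim_eq_ptheta: "euler_prod q * dlim s = (\<Sum>b. ptheta_term q s b)"
proof -
  define y where "y s = euler_prod q * dlim s - (\<Sum>b. ptheta_term q s b)" for s
  have dlim_rec: "dlim s = q powi (4 * int s + 8) * dlim (s + 3)
     + q powi int s * (1 / euler_prod q) - q powi (3 * int s + 4) * (1 / euler_prod q)" for s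
  proof (rule LIMSEQ_unique[OF dsum_tendsto])
    have "(\<lambda>M. q powi (4 * int s + 8) * dsum q M (int (s + 3)) + q powi int s * midbin q M (int (s + 1))
        - q powi (3 * int s + 4) * midbin q M (int (s + 2))) \<longlonglongrightarrow> q powi (4 * int s + 8) * dlim (s + 3)
     + q powi int s * (1 / euler_prod q) - q powi (3 * int s + 4) * (1 / euler_prod q)"
      by (intro tendsto_intros dsum_tendsto midbin_tendsto)
    then show "(\<lambda>M. dsum q M (int s)) \<longlonglongrightarrow> q powi (4 * int s + 8) * dlim (s + 3)
     + q powi int s * (1 / euler_prod q) - q powi (3 * int s + 4) * (1 / euler_prod q)"
      using dsum_recurrence[OF nz, of "int s"] by (simp add: add.commute)
  qed
  have y_rec: "y s = q powi (4 * int s + 8) * y (s + 3)" for s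
  proof -
    have "euler_prod q * dlim s = q powi (4 * int s + 8) * (euler_prod q * dlim (s + 3))
       + q powi int s - q powi (3 * int s + 4)"
      by (subst dlim_rec) (use euler_prod_nz in \<open>simp add: right_diff_distrib distrib_left\<close>)
    then show ?thesis
      unfolding y_def ptheta_recurrence[of s] by (simp add: right_diff_distrib)
  qed
  obtain C where C: "\<And>s. norm (dlim s) \<le> C" using dlim_bounds by auto
  define B where "B = norm (euler_prod q) * C + (\<Sum>b. norm q ^ b)"
  have B: "norm (y s) \<le> B" for s
  proof -
    have "norm (\<Sum>b. ptheta_term q s b) \<le> (\<Sum>b. norm q ^ b)"
      by (rule norm_suminf_le[OF norm_ptheta_term_le summable_geom])
    then show ?thesis
      unfolding y_def B_def using C[of s]
      by (intro order_trans[OF norm_triangle_ineq4] add_mono) (auto simp: norm_mult mult_left_mono)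
  qed
  have "norm (y s) \<le> norm q ^ k * B" for k s
  proof (induction k arbitrary: s)
    case (Suc k)
    have "norm (y s) = norm (q powi (4 * int s + 8)) * norm (y (s + 3))"
      using y_rec[of s] by (simp add: norm_mult)
    also have "\<dots> \<le> norm q ^ 1 * (norm q ^ k * B)"
      using Suc by (intro mult_mono norm_powi_le) auto
    finally show ?case by simp
  qed (use B in simp)
  moreover have "(\<lambda>k. norm q ^ k * B) \<longlonglongrightarrow> 0 * B"
    using lt1 by (intro tendsto_intros LIMSEQ_power_zero) auto
  ultimately have "norm (y s) \<le> 0 * B" by (intro LIMSEQ_le_const) auto
  then show ?thesis by (simp add: y_def)
qed

lemma euler_prod_mult_H:
  "(\<lambda>s. q * (pcoeff q s * (\<Sum>b. ptheta_term q s b))) sums (euler_prod q * (H q - 1))"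
  using sums_mult[OF H_eq_dlim, of "euler_prod q"] unfolding dlim_eq_ptheta[symmetric]
  by (simp add: mult_ac)

end

section \<open>The double series\<close>

lemma has_sum_int_split:
  fixes f :: "int \<Rightarrow> 'a :: {topological_comm_monoid_add, t2_space}"
  assumes "((\<lambda>n. f (int n)) has_sum A) UNIV" "((\<lambda>n. f (- 1 - int n)) has_sum B) UNIV"
  shows "(f has_sum (A + B)) UNIV"
proof -
  have "(f has_sum A) {0..}"
    using assms(1) by (subst has_sum_reindex_bij_witness[of UNIV nat int "{0..}", symmetric]) auto
  moreover have "(f has_sum B) {..- 1}"
    using assms(2)
    by (subst has_sum_reindex_bij_witness[of UNIV "\<lambda>r. nat (- 1 - r)" "\<lambda>n. - 1 - int n" "{..- 1}", symmetric]) auto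
  ultimately have "(f has_sum (A + B)) ({0..} \<union> {..- 1})"
    by (rule has_sum_Un_disjoint) auto
  also have "{0..} \<union> {..- 1} = (UNIV :: int set)" by auto
  finally show ?thesis .
qed

text \<open>The exponent of \<open>q\<close> is \<open>(3a^2 + 4ab + 3b^2 + a + b)/2\<close>.\<close>

definition dterm :: "complex \<Rightarrow> int \<times> int \<Rightarrow> complex"
  where "dterm q = (\<lambda>(a, b). pterm q a * pterm q b * q powi (2 * a * b))"

text \<open>The value at 0 is 1 because \<open>a\<close> stands for the coordinate
  \<open>a + 1/10\<close> of a lattice point.\<close>

definition isgn :: "int \<Rightarrow> complex"
  where "isgn a = (if a \<ge> 0 then 1 else - 1)"

context unit_disc
begin

lemma summable_powi_abs: "(\<lambda>a. norm q powi (\<bar>a\<bar> - 1)) summable_on (UNIV :: int set)"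
proof -
  have s: "(\<lambda>n. norm q ^ n) summable_on UNIV"
    using norm_summable_imp_summable_on[of "\<lambda>n. norm q ^ n"] summable_geom by simp
  have "(\<lambda>n. norm q powi (\<bar>int n\<bar> - 1)) summable_on UNIV"
    using summable_on_cmult_right[OF s, of "norm q powi (- 1)"] nz
    by (simp add: power_int_diff divide_inverse mult.commute power_int_minus)
  moreover have "(\<lambda>n. norm q powi (\<bar>- 1 - int n\<bar> - 1)) summable_on UNIV"
  proof -
    have "norm q powi (\<bar>- 1 - int n\<bar> - 1) = norm q ^ n" for n
    proof -
      have "\<bar>- 1 - int n\<bar> - 1 = int n" by simp
      then show ?thesis by (simp only: power_int_of_nat)
    qed
    then show ?thesis using s by simp
  qed
  ultimately show ?thesis
    unfolding summable_on_def using has_sum_int_split[of "\<lambda>a. norm q powi (\<bar>a\<bar> - 1)"] by blast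
qed

text \<open>Twice the exponent is \<open>2 (a + b)^2 + a (a + 1) + b (b + 1)\<close>, and
  \<open>c (c + 1) \<ge> 2 (|c| - 1)\<close>; this gives a product of two geometric
  majorants.\<close>

lemma summable_norm_dterm: "(\<lambda>x. norm (dterm q x)) summable_on UNIV"
proof -
  let ?g = "\<lambda>a. norm q powi (\<bar>a\<bar> - 1)"
  have "(\<lambda>(a, b). ?g a * ?g b) summable_on (UNIV \<times> UNIV)"
  proof (rule summable_on_SigmaI[where g = "\<lambda>a. ?g a * infsum ?g UNIV"])
    show "((\<lambda>b. case (a, b) of (a, b) \<Rightarrow> ?g a * ?g b) has_sum ?g a * infsum ?g UNIV) UNIV" for a
      using has_sum_cmult_right[OF has_sum_infsum[OF summable_powi_abs]] by simp
    show "(\<lambda>a. ?g a * infsum ?g UNIV) summable_on UNIV"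
      by (intro summable_on_cmult_left summable_powi_abs)
  qed auto
  then have "(\<lambda>x. norm (case x of (a, b) \<Rightarrow> ?g a * ?g b)) summable_on UNIV"
    by (simp add: case_prod_unfold abs_mult)
  then show ?thesis
  proof (rule Infinite_Sum.abs_summable_on_comparison_test)
    fix x :: "int \<times> int"
    obtain a b where x: "x = (a, b)" by (cases x)
    have ab: "c * (c + 1) \<ge> 2 * (\<bar>c\<bar> - 1)" for c :: int
    proof (cases "c \<ge> 0")
      case True
      have "0 \<le> c * (c - 1)" by (cases "c = 0") (use True in auto)
      then show ?thesis using True by (simp add: algebra_simps)
    next
      case False
      have "0 \<le> (- c - 1) * (- c - 2)" by (cases "c = - 1") (use False in auto)
      then show ?thesis using False by (simp add: algebra_simps)
    qed
    define E where "E = pent a + pent b + 2 * a * b"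
    have "2 * E = 2 * (a + b)\<^sup>2 + a * (a + 1) + b * (b + 1)"
      unfolding E_def distrib_left two_pent by (simp add: power2_eq_square algebra_simps)
    then have e: "(\<bar>a\<bar> - 1) + (\<bar>b\<bar> - 1) \<le> E"
    proof -
      have "2 * E = 2 * S + A + B \<Longrightarrow> 2 * (x - 1) \<le> A \<Longrightarrow> 2 * (y - 1) \<le> B \<Longrightarrow> 0 \<le> S
        \<Longrightarrow> (x - 1) + (y - 1) \<le> E" for S A B x y :: int by presburger
      from this[OF \<open>2 * E = _\<close> ab ab zero_le_power2] show ?thesis .
    qed
    have "norm (dterm q x) = norm q powi E"
      using nz by (simp add: E_def x dterm_def pterm_def norm_mult norm_power_int power_int_add)
    also have "\<dots> \<le> norm q powi ((\<bar>a\<bar> - 1) + (\<bar>b\<bar> - 1))"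
      using e lt1 nz by (intro power_int_decreasing) auto
    also have "\<dots> = norm (case x of (a, b) \<Rightarrow> ?g a * ?g b)"
      using nz by (subst power_int_add) (auto simp: x abs_mult)
    finally show "norm (dterm q x) \<le> norm (case x of (a, b) \<Rightarrow> ?g a * ?g b)" .
  qed
qed

lemma summable_dterm: "dterm q summable_on A"
  using abs_summable_summable[OF summable_norm_dterm] summable_on_subset_banach by blast

lemma has_sum_pterm: "(pterm q has_sum euler_prod q) UNIV"
proof -
  have s1: "summable (\<lambda>n. norm (pterm q (int n)))" "summable (\<lambda>n. norm (pterm q (- 1 - int n)))"
    using norm_powi_le[OF pent_ge(1)] norm_powi_le[OF pent_ge(2)]
    by (auto intro!: summable_comparison_test'[OF summable_geom, of 0] simp: norm_pterm)
  note s2 = s1[THEN summable_norm_cancel]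
  have "(\<Sum>n. pterm q (int n)) + (\<Sum>n. pterm q (- 1 - int n)) = euler_prod q"
  proof (rule sums_unique2)
    show "pcoeff q sums ((\<Sum>n. pterm q (int n)) + (\<Sum>n. pterm q (- 1 - int n)))"
      unfolding pcoeff_def[abs_def] by (intro sums_add summable_sums s2)
  qed (rule pentagonal)
  moreover have "(pterm q has_sum ((\<Sum>n. pterm q (int n)) + (\<Sum>n. pterm q (- 1 - int n)))) UNIV"
    by (intro has_sum_int_split norm_summable_imp_has_sum s1 summable_sums s2)
  ultimately show ?thesis by simp
qed

lemma dterm_swap: "dterm q (b, a) = dterm q (a, b)"
  by (simp add: dterm_def mult_ac)

lemma has_sum_dterm_0: "((\<lambda>b. dterm q (0, b)) has_sum euler_prod q) UNIV"
proof -
  have "pterm q 0 = 1" by (simp add: pterm_def pent_def)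
  then show ?thesis using has_sum_pterm by (simp add: dterm_def)
qed

text \<open>The part of \<open>pcoeff\<close> at \<open>- 1 - s\<close> gives the first point, the
  part at \<open>s\<close> the second. Thus the iterated series becomes one double series over a
  pair of opposite quadrants.\<close>

lemma ptheta_term_eq_dterm:
  "q * (pcoeff q s * ptheta_term q s b) = dterm q (int s + 1, int b) - dterm q (- int s, - 1 - int b)"
proof -
  have p: "pterm q (- int s) = q powi (- int s) * pterm q (int s)"
  proof -
    have "pent (- int s) = - int s + pent (int s)"
      using two_pent[of "int s"] two_pent[of "- int s"] by (simp add: algebra_simps)
    then show ?thesis
      unfolding pterm_def by (simp only: power_int_add[OF disjI1[OF nz]]) (simp add: minus_one_powi)
  qed
  have t: "ptheta_term q s b = pterm q (int b) * q powi (2 * int b + 2 * int s * int b + int s)"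
    unfolding ptheta_term_def pterm_def
    by (simp add: power_int_add[OF disjI1[OF nz]] mult_ac)
  let ?A = "pterm q (int b)" and ?B = "pterm q (int s)" and ?c = "2 * int b + 2 * int s * int b + int s"
  have "q powi 1 * (pcoeff q s * ptheta_term q s b)
      = ?A * ?B * (q powi 1 * q powi ?c - q powi 1 * q powi (2 * int s + 1) * q powi ?c)"
    unfolding t pcoeff_def pterm_reflect[OF nz]
    by (simp only: algebra_simps mult_minus_left mult_minus_right add.right_inverse add_0_left add_0_right)
  also have "\<dots> = ?A * ?B * (q powi (- int s + (2 * int b + 1) + 2 * (- int s) * (- 1 - int b))
       - q powi (3 * int s + 2 + 2 * (int s + 1) * int b))"
    unfolding powi_mult_powi(1)[OF nz] by (simp add: algebra_simps)
  also have "\<dots> = dterm q (int s + 1, int b) - dterm q (- int s, - 1 - int b)"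
    unfolding dterm_def prod.case pterm_Suc[OF nz] pterm_reflect[OF nz] p
      power_int_add[OF disjI1[OF nz], of _ "2 * (int s + 1) * int b"]
      power_int_add[OF disjI1[OF nz], of _ "2 * (- int s) * (- 1 - int b)"]
      power_int_add[OF disjI1[OF nz], of "- int s" "2 * int b + 1"]
    by (simp only: algebra_simps mult_minus_left mult_minus_right add.right_inverse)
  finally have "q powi 1 * (pcoeff q s * ptheta_term q s b) = dterm q (int s + 1, int b) - dterm q (- int s, - 1 - int b)" .
  then show ?thesis by simp
qed

section \<open>Regrouping the quadrants of the double series\<close>

abbreviation dsumset :: "int set \<Rightarrow> int set \<Rightarrow> complex"
  where "dsumset A B \<equiv> infsum (dterm q) (A \<times> B)"

lemma dsumset_Un1: "A \<inter> A' = {} \<Longrightarrow> dsumset (A \<union> A') B = dsumset A B + dsumset A' B"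
  unfolding Sigma_Un_distrib1 by (rule infsum_Un_disjoint) (auto intro: summable_dterm)

lemma dsumset_Un2: "B \<inter> B' = {} \<Longrightarrow> dsumset A (B \<union> B') = dsumset A B + dsumset A B'"
  unfolding Sigma_Un_distrib2 by (rule infsum_Un_disjoint) (auto intro: summable_dterm)

lemma dsumset_swap: "dsumset A B = dsumset B A"
  by (rule infsum_reindex_bij_witness[of _ prod.swap prod.swap]) (auto simp: dterm_swap)

lemma euler_prod_mult_H_minus_1: "euler_prod q * (H q - 1) = dsumset {1..} {0..} - dsumset {..0} {..- 1}"
proof -
  let ?K = "\<lambda>(s, b). dterm q (int s + 1, int b) - dterm q (- int s, - 1 - int b)"
  have "((\<lambda>(s, b). dterm q (int s + 1, int b)) has_sum dsumset {1..} {0..}) (UNIV \<times> UNIV)"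
    by (subst has_sum_reindex_bij_witness[of _ "\<lambda>(a, b). (nat (a - 1), nat b)" "\<lambda>(s, b). (int s + 1, int b)" "{1..} \<times> {0..}"])
       (auto intro: has_sum_infsum summable_dterm)
  moreover have "((\<lambda>(s, b). dterm q (- int s, - 1 - int b)) has_sum dsumset {..0} {..- 1}) (UNIV \<times> UNIV)"
    by (subst has_sum_reindex_bij_witness[of _ "\<lambda>(a, b). (nat (- a), nat (- 1 - b))" "\<lambda>(s, b). (- int s, - 1 - int b)" "{..0} \<times> {..- 1}"])
       (auto intro: has_sum_infsum summable_dterm)
  ultimately have "(?K has_sum (dsumset {1..} {0..} - dsumset {..0} {..- 1})) (UNIV \<times> UNIV)"
    using has_sum_add[OF _ has_sum_uminusI] by (fastforce simp: case_prod_unfold)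
  then have "((\<lambda>s. q * (pcoeff q s * (\<Sum>b. ptheta_term q s b))) has_sum (dsumset {1..} {0..} - dsumset {..0} {..- 1})) UNIV"
  proof (rule has_sum_SigmaD)
    fix s :: nat
    have "(ptheta_term q s has_sum (\<Sum>b. ptheta_term q s b)) UNIV"
      by (intro norm_summable_imp_has_sum summable_sums summable_ptheta_term
           summable_comparison_test'[OF summable_geom, of 0]) (simp add: norm_ptheta_term_le)
    from has_sum_cmult_right[OF this, of "q * pcoeff q s"]
    show "((\<lambda>b. ?K (s, b)) has_sum q * (pcoeff q s * (\<Sum>b. ptheta_term q s b))) UNIV"
      by (simp add: mult.assoc ptheta_term_eq_dterm)
  qed
  then show ?thesis
    using euler_prod_mult_H has_sum_imp_sums sums_unique2 by blast
qed

text \<open>The row \<open>a = 0\<close> sums to \<open>euler_prod q\<close>. Added to both sides,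
  its half \<open>b \<ge> 0\<close> completes the first quadrant and its half \<open>b < 0\<close>
  removes the boundary row of the second.\<close>

lemma euler_prod_mult_H_eq: "euler_prod q * H q = dsumset {0..} {0..} - dsumset {..- 1} {..- 1}"
proof -
  have "euler_prod q = dsumset {0} UNIV"
  proof -
    have "(dterm q has_sum euler_prod q) ({0} \<times> UNIV)"
      using has_sum_dterm_0
      by (subst has_sum_reindex_bij_witness[of UNIV snd "\<lambda>b. (0, b)", symmetric]) auto
    then show ?thesis by (simp add: infsumI)
  qed
  also have "UNIV = {0..} \<union> {..(- 1 :: int)}" by auto
  also have "dsumset {0} \<dots> = dsumset {0} {0..} + dsumset {0} {..- 1}"
    by (rule dsumset_Un2) auto
  finally have E: "euler_prod q = \<dots>" .
  have "dsumset ({1..} \<union> {0}) {0..} = dsumset {1..} {0..} + dsumset {0} {0..}"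
    by (rule dsumset_Un1) auto
  moreover have "{1..} \<union> {0} = {(0::int)..}" by auto
  moreover have "dsumset ({..- 1} \<union> {0}) {..- 1} = dsumset {..- 1} {..- 1} + dsumset {0} {..- 1}"
    by (rule dsumset_Un1) auto
  moreover have "{..- 1} \<union> {0} = {..(0::int)}" by auto
  ultimately show ?thesis
    using E euler_prod_mult_H_minus_1 by (simp add: algebra_simps)
qed

text \<open>The quadrants of mixed sign enter with opposite signs and agree under
  \<open>dsumset_swap\<close>. The sign may thus depend on one coordinate alone, and by symmetry on
  either; hence the two halves in the theorem coincide.\<close>

lemma dsumset_UNIV: "dsumset {0..} UNIV - dsumset {..- 1} UNIV = euler_prod q * H q"
proof -
  have "dsumset A ({0..} \<union> {..- 1}) = dsumset A {0..} + dsumset A {..- 1}" for A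
    by (rule dsumset_Un2) auto
  moreover have "{0..} \<union> {..- 1} = (UNIV :: int set)" by auto
  ultimately show ?thesis
    using dsumset_swap[of "{0..}" "{..- 1}"] by (simp add: euler_prod_mult_H_eq)
qed

lemma has_sum_isgn_dterm: "((\<lambda>(a, b). isgn a * dterm q (a, b)) has_sum (euler_prod q * H q)) UNIV"
proof -
  have "((\<lambda>(a, b). isgn a * dterm q (a, b)) has_sum dsumset {0..} UNIV) ({0..} \<times> UNIV)"
    using has_sum_infsum[OF summable_dterm] by (subst has_sum_cong[where g = "dterm q"]) (auto simp: isgn_def)
  moreover have "((\<lambda>(a, b). isgn a * dterm q (a, b)) has_sum (- dsumset {..- 1} UNIV)) ({..- 1} \<times> UNIV)"
    using has_sum_uminusI[OF has_sum_infsum[OF summable_dterm]]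
    by (subst has_sum_cong[where g = "\<lambda>x. - dterm q x"]) (auto simp: isgn_def)
  ultimately have "((\<lambda>(a, b). isgn a * dterm q (a, b)) has_sum (dsumset {0..} UNIV + - dsumset {..- 1} UNIV))
      ({0..} \<times> UNIV \<union> {..- 1} \<times> UNIV)"
    by (rule has_sum_Un_disjoint) auto
  also have "{0..} \<times> UNIV \<union> {..- 1} \<times> UNIV = (UNIV :: (int \<times> int) set)" by auto
  finally show ?thesis using dsumset_UNIV by simp
qed

lemma has_sum_isgn_dterm': "((\<lambda>(a, b). isgn b * dterm q (a, b)) has_sum (euler_prod q * H q)) UNIV"
  using has_sum_isgn_dterm
  by (subst has_sum_reindex_bij_witness[of UNIV prod.swap prod.swap UNIV "\<lambda>(a, b). isgn a * dterm q (a, b)"])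
     (auto simp: dterm_swap)

section \<open>The single false theta series\<close>

lemma pterm_mult: "pterm q a * pterm q b * q powi c = (- 1) powi (a + b) * q powi (pent a + pent b + c)"
  unfolding pterm_def power_int_add[OF disjI1[OF nz]] by (simp add: power_int_add)

text \<open>Substituting \<open>b - 2 * m\<close> for \<open>b\<close> absorbs the cross term, so
  the row is a multiple of the pentagonal series.\<close>

lemma has_sum_dterm_3m: "((\<lambda>b. dterm q (3 * m, b)) has_sum (false1 q m * euler_prod q)) UNIV"
proof -
  have "false1 q m * pterm q b = dterm q (3 * m, b - 2 * m)" for b
  proof -
    have "2 * (exp1 m + pent b) = 2 * (pent (3 * m) + pent (b - 2 * m) + 2 * (3 * m) * (b - 2 * m))"
      unfolding distrib_left two_exp1 two_pent by (simp add: power2_eq_square algebra_simps)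
    then have e: "exp1 m + pent b = pent (3 * m) + pent (b - 2 * m) + 2 * (3 * m) * (b - 2 * m)" by simp
    have "false1 q m * pterm q b = ((- 1) powi m * (- 1) powi b) * q powi (exp1 m + pent b)"
      by (simp add: false1_def pterm_def power_int_add[OF disjI1[OF nz]])
    also have "\<dots> = dterm q (3 * m, b - 2 * m)"
      unfolding dterm_def prod.case pterm_mult e by (simp add: minus_one_powi)
    finally show ?thesis .
  qed
  then show ?thesis
    using has_sum_cmult_right[OF has_sum_pterm, of "false1 q m"]
    by (subst has_sum_reindex_bij_witness[of UNIV "\<lambda>b. b - 2 * m" "\<lambda>b. b + 2 * m" UNIV "\<lambda>b. false1 q m * pterm q b"]) auto
qed

lemma has_sum_dterm_3m_1: "((\<lambda>b. dterm q (3 * m + 1, b)) has_sum (false2 q m * euler_prod q)) UNIV"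
proof -
  have "false2 q m * pterm q b = dterm q (3 * m + 1, - 1 - 2 * m - b)" for b
  proof -
    have "2 * (exp2 m + pent b) = 2 * (pent (3 * m + 1) + pent (- 1 - 2 * m - b) + 2 * (3 * m + 1) * (- 1 - 2 * m - b))"
      unfolding distrib_left two_exp2 two_pent by (simp add: power2_eq_square algebra_simps)
    then have e: "exp2 m + pent b = pent (3 * m + 1) + pent (- 1 - 2 * m - b) + 2 * (3 * m + 1) * (- 1 - 2 * m - b)" by simp
    have "false2 q m * pterm q b = ((- 1) powi m * (- 1) powi b) * q powi (exp2 m + pent b)"
      by (simp add: false2_def pterm_def power_int_add[OF disjI1[OF nz]])
    also have "\<dots> = dterm q (3 * m + 1, - 1 - 2 * m - b)"
      unfolding dterm_def prod.case pterm_mult e by (simp add: minus_one_powi)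
    finally show ?thesis .
  qed
  then show ?thesis
    using has_sum_cmult_right[OF has_sum_pterm, of "false2 q m"]
    by (subst has_sum_reindex_bij_witness[of UNIV "\<lambda>b. - 1 - 2 * m - b" "\<lambda>b. - 1 - 2 * m - b" UNIV "\<lambda>b. false2 q m * pterm q b"]) auto
qed

text \<open>The reflection \<open>b \<mapsto> - 3 - 4 * m - b\<close> preserves the exponent and
  changes the sign, so the row cancels.\<close>

lemma has_sum_dterm_3m_2: "((\<lambda>b. dterm q (3 * m + 2, b)) has_sum 0) UNIV"
proof -
  let ?f = "\<lambda>b. dterm q (3 * m + 2, b)"
  have neg: "?f (- 3 - 4 * m - b) = - ?f b" for b
  proof -
    have "2 * (pent (3 * m + 2) + pent (- 3 - 4 * m - b) + 2 * (3 * m + 2) * (- 3 - 4 * m - b))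
        = 2 * (pent (3 * m + 2) + pent b + 2 * (3 * m + 2) * b)"
      unfolding distrib_left two_pent by (simp add: power2_eq_square algebra_simps)
    then have *: "pent (3 * m + 2) + pent (- 3 - 4 * m - b) + 2 * (3 * m + 2) * (- 3 - 4 * m - b)
        = pent (3 * m + 2) + pent b + 2 * (3 * m + 2) * b" by simp
    show ?thesis
      unfolding dterm_def prod.case pterm_mult * by (simp add: minus_one_powi)
  qed
  have "(dterm q \<circ> Pair (3 * m + 2)) summable_on UNIV"
    using summable_on_reindex[of "Pair (3 * m + 2)" UNIV "dterm q"] summable_dterm by (simp add: inj_on_def)
  then have s: "(?f has_sum infsum ?f UNIV) UNIV" by (simp add: o_def)
  moreover have "((\<lambda>b. - ?f b) has_sum infsum ?f UNIV) UNIV"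
    using s by (subst has_sum_reindex_bij_witness[of UNIV "\<lambda>b. - 3 - 4 * m - b" "\<lambda>b. - 3 - 4 * m - b" UNIV ?f])
      (auto simp: neg)
  ultimately have "infsum ?f UNIV = - infsum ?f UNIV"
    using has_sum_uminusI[OF s] has_sum_unique by blast
  then show ?thesis using s by simp
qed

text \<open>The double series is summed by rows, and rows are grouped by three. The row index modulo
  3 selects \<open>false1\<close>, \<open>false2\<close> or 0, and the common factor
  \<open>euler_prod q\<close> cancels.\<close>

lemma H_sums_false: "(\<lambda>m. false1 q (int m) + false2 q (int m) - false1 q (- 1 - int m) - false2 q (- 1 - int m)) sums H q"
proof -
  define \<theta> where "\<theta> a = infsum (\<lambda>b. dterm q (a, b)) UNIV" for a
  have \<theta>: "\<theta> (3 * m) = false1 q m * euler_prod q" "\<theta> (3 * m + 1) = false2 q m * euler_prod q" "\<theta> (3 * m + 2) = 0" for m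
    using has_sum_dterm_3m has_sum_dterm_3m_1 has_sum_dterm_3m_2 by (auto simp: \<theta>_def intro: infsumI)
  have inner: "((\<lambda>b. dterm q (a, b)) has_sum \<theta> a) UNIV" for a
  proof -
    have "(dterm q \<circ> Pair a) summable_on UNIV"
      using summable_on_reindex[of "Pair a" UNIV "dterm q"] summable_dterm by (simp add: inj_on_def)
    then show ?thesis unfolding \<theta>_def by (simp add: o_def)
  qed
  have "(\<theta> has_sum dsumset {0..} UNIV) {0..}"
    by (rule has_sum_SigmaD[OF has_sum_infsum[OF summable_dterm] inner])
  then have 1: "((\<lambda>s. \<theta> (int s)) has_sum dsumset {0..} UNIV) UNIV"
    by (subst has_sum_reindex_bij_witness[of UNIV nat int "{0..}"]) auto
  have "(\<theta> has_sum dsumset {..- 1} UNIV) {..- 1}"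
    by (rule has_sum_SigmaD[OF has_sum_infsum[OF summable_dterm] inner])
  then have 2: "((\<lambda>s. \<theta> (- 1 - int s)) has_sum dsumset {..- 1} UNIV) UNIV"
    by (subst has_sum_reindex_bij_witness[of UNIV "\<lambda>r. nat (- 1 - r)" "\<lambda>n. - 1 - int n" "{..- 1}"]) auto
  have "(\<lambda>s. \<theta> (int s) - \<theta> (- 1 - int s)) sums (euler_prod q * H q)"
    using sums_diff[OF has_sum_imp_sums[OF 1] has_sum_imp_sums[OF 2]] by (simp add: dsumset_UNIV)
  from sums_group[OF this, of 3]
  have "(\<lambda>m. \<Sum>s = m * 3..<m * 3 + 3. \<theta> (int s) - \<theta> (- 1 - int s)) sums (euler_prod q * H q)" by simp
  moreover have "(\<Sum>s = m * 3..<m * 3 + 3. \<theta> (int s) - \<theta> (- 1 - int s))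
     = euler_prod q * (false1 q (int m) + false2 q (int m) - false1 q (- 1 - int m) - false2 q (- 1 - int m))" for m
  proof -
    have "{m * 3..<m * 3 + 3} = {3 * m, 3 * m + 1, 3 * m + 2}" by auto
    moreover have "- 1 - 3 * int m = 3 * (- 1 - int m) + 2" "- 2 - 3 * int m = 3 * (- 1 - int m) + 1"
       "- 3 - 3 * int m = 3 * (- 1 - int m)" by simp_all
    ultimately show ?thesis
      using \<theta>[of "int m"] \<theta>[of "- 1 - int m"] by (simp add: algebra_simps)
  qed
  ultimately have "(\<lambda>m. euler_prod q * (false1 q (int m) + false2 q (int m) - false1 q (- 1 - int m) - false2 q (- 1 - int m)))
     sums (euler_prod q * H q)" by simp
  then show ?thesis using euler_prod_nz by (simp add: sums_mult_iff)
qed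

end

section \<open>Radial limits of antiperiodic theta series\<close>

text \<open>With \<open>z = s * E\<close> the parameter \<open>s\<close> enters only through
  \<open>z * exp (- z)\<close> and \<open>z^2 * exp (- z)\<close>, which are bounded; hence the
  estimate is uniform in \<open>s\<close>. Here \<open>d\<close> and \<open>h\<close> play the first
  and second differences of a quadratic exponent.\<close>

lemma exp_second_difference_bound:
  fixes s E d h :: real
  assumes "s \<ge> 0" "E > 0" "d \<ge> 0" "h \<ge> 0"
  shows "\<bar>exp (- s * E) - 2 * exp (- s * (E + d)) + exp (- s * (E + 2 * d + h))\<bar> \<le> 2 * (d / E)\<^sup>2 + h / E"
proof -
  define z where "z = s * E"
  have z: "z \<ge> 0" using assms by (simp add: z_def)
  have ez: "exp z \<ge> 1 + z + z\<^sup>2 / 2"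
    by (rule exp_lower_Taylor_quadratic[OF z])
  have z1: "z * exp (- z) \<le> 1" and z2: "z\<^sup>2 * exp (- z) \<le> 2"
  proof -
    have "z \<le> exp z" "z\<^sup>2 \<le> 2 * exp z" using ez z zero_le_power2[of z] by linarith+
    then show "z * exp (- z) \<le> 1" "z\<^sup>2 * exp (- z) \<le> 2" unfolding exp_minus by (simp_all add: divide_simps)
  qed
  have u: "0 \<le> 1 - exp (- s * d)" "1 - exp (- s * d) \<le> s * d"
    using assms exp_ge_add_one_self[of "- s * d"] by auto
  have v: "0 \<le> 1 - exp (- s * h)" "1 - exp (- s * h) \<le> s * h"
    using assms exp_ge_add_one_self[of "- s * h"] by auto
  have w: "0 \<le> (exp (- s * d))\<^sup>2" "(exp (- s * d))\<^sup>2 \<le> 1"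
    using assms by (auto simp: power_le_one)
  have "exp (- s * E) - 2 * exp (- s * (E + d)) + exp (- s * (E + 2 * d + h))
      = exp (- z) * ((1 - exp (- s * d))\<^sup>2 - (exp (- s * d))\<^sup>2 * (1 - exp (- s * h)))"
    by (simp add: z_def power2_eq_square algebra_simps flip: exp_add)
  also have "\<bar>\<dots>\<bar> = exp (- z) * \<bar>(1 - exp (- s * d))\<^sup>2 - (exp (- s * d))\<^sup>2 * (1 - exp (- s * h))\<bar>"
    by (simp add: abs_mult)
  also have "\<dots> \<le> exp (- z) * ((s * d)\<^sup>2 + s * h)"
  proof (rule mult_left_mono)
    have "(1 - exp (- s * d))\<^sup>2 \<le> (s * d)\<^sup>2" by (rule power_mono[OF u(2,1)])
    moreover have "(exp (- s * d))\<^sup>2 * (1 - exp (- s * h)) \<le> 1 * (s * h)"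
      using v w by (intro mult_mono) auto
    moreover have "0 \<le> (exp (- s * d))\<^sup>2 * (1 - exp (- s * h))" using v w by simp
    moreover have "0 \<le> (1 - exp (- s * d))\<^sup>2" by simp
    ultimately show "\<bar>(1 - exp (- s * d))\<^sup>2 - (exp (- s * d))\<^sup>2 * (1 - exp (- s * h))\<bar> \<le> (s * d)\<^sup>2 + s * h"
      by linarith
  qed simp
  also have "\<dots> = (z\<^sup>2 * exp (- z)) * (d / E)\<^sup>2 + (z * exp (- z)) * (h / E)"
    using assms(2) by (simp add: z_def power2_eq_square field_simps)
  also have "\<dots> \<le> 2 * (d / E)\<^sup>2 + 1 * (h / E)"
    using z1 z2 assms by (intro add_mono mult_right_mono) auto
  finally show ?thesis by simp
qed

text \<open>Antiperiodicity turns the series into a finite sum plus its second differences with step \<open>N\<close>,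
  to which Tannery's theorem applies.\<close>

lemma antiperiodic_theta:
  fixes a :: "nat \<Rightarrow> complex" and E :: "nat \<Rightarrow> real"
  assumes anti: "\<And>m. a (m + N) = - a m" and a_le: "\<And>m. norm (a m) \<le> 1"
    and E: "\<And>m. E m = (15 * (real m)\<^sup>2 + \<beta> * real m + \<gamma>) / 2" and "\<beta> \<ge> 0" "\<gamma> \<ge> 0"
  shows "s > 0 \<Longrightarrow> summable (\<lambda>m. a m * of_real (exp (- s * E m)))"
    and "((\<lambda>s. \<Sum>m. a m * of_real (exp (- s * E m))) \<longlongrightarrow> (\<Sum>m<N. a m) / 2) (at_right 0)"
proof -
  define g where "g s m = complex_of_real (exp (- s * E m))" for s m
  have E_ge: "E m \<ge> (real m)\<^sup>2" for m
  proof -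
    have "2 * (real m)\<^sup>2 \<le> 15 * (real m)\<^sup>2" by simp
    moreover have "0 \<le> \<beta> * real m + \<gamma>" using assms by simp
    ultimately have "2 * (real m)\<^sup>2 + 0 \<le> 15 * (real m)\<^sup>2 + (\<beta> * real m + \<gamma>)" by (rule add_mono)
    then show ?thesis unfolding E by (simp add: add.assoc)
  qed
  have summ: "summable (\<lambda>m. a m * g s m)" if "s > 0" for s
  proof (rule summable_comparison_test'[of "\<lambda>m. exp (- s) ^ m" 0])
    show "summable (\<lambda>m. exp (- s) ^ m)" using that by (simp add: summable_geometric)
    fix m
    have "real m \<le> (real m)\<^sup>2" by (cases m) (auto simp: power2_eq_square)
    then have "real m \<le> E m" using E_ge[of m] by (rule order_trans)
    then have "s * real m \<le> s * E m" using that by (intro mult_left_mono) auto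
    then have "exp (- s * E m) \<le> exp (- s) ^ m" by (simp flip: exp_of_nat_mult add: mult.commute)
    moreover have "norm (a m * g s m) \<le> 1 * exp (- s * E m)"
      unfolding norm_mult g_def using a_le by (intro mult_mono) auto
    ultimately show "norm (a m * g s m) \<le> exp (- s) ^ m" by simp
  qed
  then show "s > 0 \<Longrightarrow> summable (\<lambda>m. a m * of_real (exp (- s * E m)))" by (simp add: g_def)
  define G where "G s = (\<Sum>m. a m * g s m)" for s
  define D where "D m s = a m * (g s m - 2 * g s (m + N) + g s (m + 2 * N))" for m s
  \<comment> \<open>By antiperiodicity the second differences, with weights 1, -2, 1, sum to
    \<open>4 * G s\<close> minus finitely many initial terms.\<close>
  have G_eq: "G s = ((\<Sum>m. D m s) + 2 * (\<Sum>m<N. a m * g s m) + (\<Sum>m<2 * N. a m * g s m)) / 4" if "s > 0" for s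
  proof -
    have a2: "a (m + 2 * N) = a m" for m
      using anti[of "m + N"] anti[of m] by (simp add: mult_2 add.assoc)
    have s1: "(\<lambda>m. a m * g s m) sums G s"
      unfolding G_def by (rule summable_sums[OF summ[OF that]])
    have s2: "(\<lambda>m. - a m * g s (m + N)) sums (G s - (\<Sum>m<N. a m * g s m))"
      using sums_split_initial_segment[OF s1, of N] unfolding anti .
    have s3: "(\<lambda>m. a m * g s (m + 2 * N)) sums (G s - (\<Sum>m<2 * N. a m * g s m))"
      using sums_split_initial_segment[OF s1, of "2 * N"] unfolding a2 .
    have "(\<lambda>m. D m s) sums (G s + 2 * (G s - (\<Sum>m<N. a m * g s m)) + (G s - (\<Sum>m<2 * N. a m * g s m)))"
      using sums_add[OF sums_add[OF s1 sums_mult[OF s2, of 2]] s3]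
      by (simp add: D_def algebra_simps)
    from sums_unique[OF this] show ?thesis by (simp add: field_simps)
  qed
  \<comment> \<open>Chosen so that the first difference is at most \<open>K * m\<close> for
    \<open>m \<ge> 1\<close>; as \<open>E m \<ge> m^2\<close>, this yields a majorant of order
    \<open>1 / m^2\<close>, independent of \<open>s\<close>.\<close>
  define K where "K = (30 * real N + 15 * (real N)\<^sup>2 + \<beta> * real N) / 2"
  have D_lim: "((\<lambda>s. \<Sum>m. D m s) \<longlongrightarrow> (\<Sum>m. 0)) (at_right 0)"
  proof (rule tannerys_theorem[THEN conjunct2, THEN conjunct2])
    show "(D m \<longlongrightarrow> 0) (at_right 0)" for m
      unfolding D_def g_def by (rule tendsto_eq_intros refl | simp)+
    show "\<forall>\<^sub>F (m, s) in sequentially \<times>\<^sub>F at_right 0. norm (D m s) \<le> (2 * K\<^sup>2 + 15 * (real N)\<^sup>2) * (1 / (real m)\<^sup>2)"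
    proof (rule eventually_mono)
      show "\<forall>\<^sub>F (m, s) in sequentially \<times>\<^sub>F at_right 0. m \<ge> 1 \<and> s > (0::real)"
        using eventually_prodI[OF eventually_ge_at_top[of "1::nat"] eventually_at_right_less[of "0::real"]]
        by (simp add: case_prod_unfold)
      fix x :: "nat \<times> real"
      assume "case x of (m, s) \<Rightarrow> m \<ge> 1 \<and> s > 0"
      then obtain m s where x: "x = (m, s)" and m: "m \<ge> 1" and s: "s > 0" by (cases x) auto
      define d where "d = (30 * real m * real N + 15 * (real N)\<^sup>2 + \<beta> * real N) / 2"
      have e: "E (m + N) = E m + d" "E (m + 2 * N) = E m + 2 * d + 15 * (real N)\<^sup>2"
        unfolding E d_def by (simp_all add: power2_eq_square field_simps)
      have Em: "E m > 0" using E_ge[of m] m by (smt (verit) of_nat_0_less_iff zero_less_power le_numeral_extra(4) less_le_trans zero_less_one)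
      have d0: "d \<ge> 0" unfolding d_def using assms by simp
      have "d \<le> K * real m"
      proof -
        have "x \<le> x * real m" if "x \<ge> 0" for x using m mult_left_mono[of 1 "real m" x] that by simp
        from this[of "15 * (real N)\<^sup>2 + \<beta> * real N"] show ?thesis
          unfolding d_def K_def using assms by (simp add: field_simps)
      qed
      then have "d / E m \<le> K * real m / (real m)\<^sup>2"
        using d0 E_ge[of m] m by (intro frac_le) auto
      also have "\<dots> = K / real m" by (simp add: power2_eq_square)
      finally have dE: "(d / E m)\<^sup>2 \<le> (K / real m)\<^sup>2"
        using d0 Em by (intro power_mono) auto
      have "norm (D m s) \<le> 1 * norm (g s m - 2 * g s (m + N) + g s (m + 2 * N))"
        unfolding D_def norm_mult by (intro mult_right_mono a_le) auto
      also have "g s m - 2 * g s (m + N) + g s (m + 2 * N)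
         = of_real (exp (- s * E m) - 2 * exp (- s * (E m + d)) + exp (- s * (E m + 2 * d + 15 * (real N)\<^sup>2)))"
        unfolding g_def e by simp
      also have "1 * norm \<dots> \<le> 2 * (d / E m)\<^sup>2 + 15 * (real N)\<^sup>2 / E m"
        unfolding norm_of_real mult_1_left
        by (rule exp_second_difference_bound) (use s Em d0 in auto)
      also have "\<dots> \<le> 2 * (K / real m)\<^sup>2 + 15 * (real N)\<^sup>2 / (real m)\<^sup>2"
        using dE E_ge[of m] m Em by (intro add_mono mult_left_mono divide_left_mono) auto
      also have "\<dots> = (2 * K\<^sup>2 + 15 * (real N)\<^sup>2) * (1 / (real m)\<^sup>2)"
        by (simp add: power_divide add_divide_distrib)
      finally show "case x of (m, s) \<Rightarrow> norm (D m s) \<le> (2 * K\<^sup>2 + 15 * (real N)\<^sup>2) * (1 / (real m)\<^sup>2)"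
        by (simp add: x)
    qed
    show "summable (\<lambda>m. (2 * K\<^sup>2 + 15 * (real N)\<^sup>2) * (1 / (real m)\<^sup>2))"
      using inverse_power_summable[of 2, where 'a = real] by (intro summable_mult) (simp add: inverse_eq_divide)
  qed simp
  have "((\<lambda>s. ((\<Sum>m. D m s) + 2 * (\<Sum>m<N. a m * g s m) + (\<Sum>m<2 * N. a m * g s m)) / 4)
      \<longlongrightarrow> (0 + 2 * (\<Sum>m<N. a m) + (\<Sum>m<2 * N. a m)) / 4) (at_right 0)"
  proof -
    have g: "((\<lambda>s. a m * g s m) \<longlongrightarrow> a m) (at_right 0)" for m
      unfolding g_def by (rule tendsto_eq_intros refl | simp)+
    have "((\<lambda>s. \<Sum>m<M. a m * g s m) \<longlongrightarrow> (\<Sum>m<M. a m)) (at_right 0)" for M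
      by (rule tendsto_sum) (rule g)
    from tendsto_divide[OF tendsto_add[OF tendsto_add[OF D_lim tendsto_mult[OF tendsto_const this]] this] tendsto_const]
    show ?thesis by simp
  qed
  moreover have "\<forall>\<^sub>F s in at_right 0. ((\<Sum>m. D m s) + 2 * (\<Sum>m<N. a m * g s m) + (\<Sum>m<2 * N. a m * g s m)) / 4 = G s"
    using eventually_at_right_less[of "0::real"] by eventually_elim (simp add: G_eq)
  ultimately have "(G \<longlongrightarrow> (0 + 2 * (\<Sum>m<N. a m) + (\<Sum>m<2 * N. a m)) / 4) (at_right 0)"
    by (rule Lim_transform_eventually)
  \<comment> \<open>Two consecutive periods cancel, which leaves \<open>2 / 4\<close> of the sum
    over one period.\<close>
  moreover have "(\<Sum>m<2 * N. a m) = 0"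
  proof -
    have "(\<Sum>m<N + M. a m) = (\<Sum>m<N. a m) + (\<Sum>m<M. a (m + N))" for M
      by (induction M) (simp_all add: add_ac)
    from this[of N] show ?thesis using anti by (simp add: sum_negf mult_2)
  qed
  ultimately show "((\<lambda>s. \<Sum>m. a m * of_real (exp (- s * E m))) \<longlongrightarrow> (\<Sum>m<N. a m) / 2) (at_right 0)"
    unfolding G_def g_def by simp
qed

context primitive_root
begin

text \<open>Each of the four subseries is antiperiodic and tends to half its sum over one period.
  The negative indices double the contribution of the others, and \<open>H_root_eq_sum_false\<close>
  identifies the total.\<close>

lemma H_tendsto:
  "((\<lambda>s. H (q * of_real (exp (- s)))) \<longlongrightarrow> 2 * H q) (at_right 0)"
proof -
  have norm_q: "norm q = 1"
    using root N_pos by (metis norm_one norm_power norm_ge_zero power_eq_1_iff less_not_refl)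
  define E1 where "E1 \<beta> \<gamma> m = (15 * (real m)\<^sup>2 + \<beta> * real m + \<gamma>) / 2" for \<beta> \<gamma> m
  define G where "G f \<beta> \<gamma> s = (\<Sum>m. f (m::nat) * complex_of_real (exp (- s * E1 \<beta> \<gamma> m)))" for f \<beta> \<gamma> s
  let ?a = "\<lambda>m. false1 q (int m)" and ?b = "\<lambda>m. false2 q (int m)"
  let ?c = "\<lambda>m. false1 q (- 1 - int m)" and ?d = "\<lambda>m. false2 q (- 1 - int m)"
  have anti: "?a (m + N) = - ?a m" "?b (m + N) = - ?b m" "?c (m + N) = - ?c m" "?d (m + N) = - ?d m" for m
    using false1_antiperiodic[of "int m"] false2_antiperiodic[of "int m"]
      false1_antiperiodic[of "- 1 - int (m + N)"] false2_antiperiodic[of "- 1 - int (m + N)"] by simp_all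
  have le: "norm (false1 q r) \<le> 1" "norm (false2 q r) \<le> 1" for r
    by (simp_all add: false1_def false2_def norm_mult norm_power_int norm_q)
  note th = antiperiodic_theta[where E = "E1 \<beta> \<gamma>" for \<beta> \<gamma>, OF _ _ E1_def]
  note tha = th[where a = ?a, OF anti(1) le(1)] and thb = th[where a = ?b, OF anti(2) le(2)]
    and thc = th[where a = ?c, OF anti(3) le(1)] and thd = th[where a = ?d, OF anti(4) le(2)]
  \<comment> \<open>The pairs \<open>29 14\<close> and \<open>19 6\<close> come from expanding
    \<open>exp1\<close> and \<open>exp2\<close> at \<open>- 1 - m\<close>.\<close>
  have summ: "summable (\<lambda>m. ?a m * of_real (exp (- s * E1 1 0 m)))"
      "summable (\<lambda>m. ?b m * of_real (exp (- s * E1 11 2 m)))"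
      "summable (\<lambda>m. ?c m * of_real (exp (- s * E1 29 14 m)))"
      "summable (\<lambda>m. ?d m * of_real (exp (- s * E1 19 6 m)))" if "s > 0" for s
    by (rule tha(1) thb(1) thc(1) thd(1),
        simp, simp, rule that)+
  have lim: "(G ?a 1 0 \<longlongrightarrow> (\<Sum>m<N. ?a m) / 2) (at_right 0)"
      "(G ?b 11 2 \<longlongrightarrow> (\<Sum>m<N. ?b m) / 2) (at_right 0)"
      "(G ?c 29 14 \<longlongrightarrow> (\<Sum>m<N. ?c m) / 2) (at_right 0)"
      "(G ?d 19 6 \<longlongrightarrow> (\<Sum>m<N. ?d m) / 2) (at_right 0)"
    unfolding G_def
    by (rule tha(2) thb(2) thc(2) thd(2),
        simp, simp)+
  have H: "G ?a 1 0 s + G ?b 11 2 s - G ?c 29 14 s - G ?d 19 6 s = H (q * of_real (exp (- s)))" if "s > 0" for s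
  proof -
    let ?q = "q * complex_of_real (exp (- s))"
    interpret unit_disc ?q
      by standard (use that nz in \<open>simp_all add: norm_mult norm_q\<close>)
    have pw: "?q powi e = q powi e * of_real (exp (- s * real_of_int e))" for e
    proof -
      have "complex_of_real (exp (- s)) powi e = of_real (exp (- s * real_of_int e))"
        unfolding of_real_power_int[symmetric] exp_power_int by (simp add: mult.commute)
      then show ?thesis by (simp add: power_int_mult_distrib)
    qed
    have r1: "real_of_int (exp1 m) = (15 * (real_of_int m)\<^sup>2 + real_of_int m) / 2" for m
      using arg_cong[OF two_exp1[of m], of real_of_int] by simp
    have r2: "real_of_int (exp2 m) = (15 * (real_of_int m)\<^sup>2 + 11 * real_of_int m + 2) / 2" for m
      using arg_cong[OF two_exp2[of m], of real_of_int] by simp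
    have f: "false1 ?q (int m) = ?a m * of_real (exp (- s * E1 1 0 m))"
        "false2 ?q (int m) = ?b m * of_real (exp (- s * E1 11 2 m))"
        "false1 ?q (- 1 - int m) = ?c m * of_real (exp (- s * E1 29 14 m))"
        "false2 ?q (- 1 - int m) = ?d m * of_real (exp (- s * E1 19 6 m))" for m
    proof -
      have e: "real_of_int (exp1 (int m)) = E1 1 0 m" "real_of_int (exp2 (int m)) = E1 11 2 m"
        "real_of_int (exp1 (- 1 - int m)) = E1 29 14 m" "real_of_int (exp2 (- 1 - int m)) = E1 19 6 m"
        unfolding r1 r2 E1_def by (simp_all add: power2_eq_square algebra_simps)
      show "false1 ?q (int m) = ?a m * of_real (exp (- s * E1 1 0 m))"
        "false2 ?q (int m) = ?b m * of_real (exp (- s * E1 11 2 m))"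
        "false1 ?q (- 1 - int m) = ?c m * of_real (exp (- s * E1 29 14 m))"
        "false2 ?q (- 1 - int m) = ?d m * of_real (exp (- s * E1 19 6 m))"
        unfolding false1_def false2_def pw e by (simp_all only: mult.assoc)
    qed
    have "(\<lambda>m. false1 ?q (int m) + false2 ?q (int m) - false1 ?q (- 1 - int m) - false2 ?q (- 1 - int m))
        sums (G ?a 1 0 s + G ?b 11 2 s - G ?c 29 14 s - G ?d 19 6 s)"
      unfolding f G_def using that by (intro sums_diff sums_add summable_sums summ)
    then show ?thesis using H_sums_false sums_unique2 by blast
  qed
  have "((\<lambda>s. G ?a 1 0 s + G ?b 11 2 s - G ?c 29 14 s - G ?d 19 6 s) \<longlongrightarrow>
     (\<Sum>m<N. ?a m) / 2 + (\<Sum>m<N. ?b m) / 2 - (\<Sum>m<N. ?c m) / 2 - (\<Sum>m<N. ?d m) / 2) (at_right 0)"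
    by (intro tendsto_intros lim)
  moreover have "(\<Sum>m<N. ?a m) / 2 + (\<Sum>m<N. ?b m) / 2 - (\<Sum>m<N. ?c m) / 2 - (\<Sum>m<N. ?d m) / 2 = 2 * H q"
  proof -
    have "isum f (- int N) = isum f (int N)" if "\<And>m. f (m + int N) = - f m" for f
      using isum_quasiperiodic[of f "int N" "- 1" "- int N"] that by simp
    from this[of "false1 q"] this[of "false2 q"] show ?thesis
      using false1_antiperiodic false2_antiperiodic H_root_eq_sum_false
        sum_upward[of "false1 q" 0 N] sum_upward[of "false2 q" 0 N]
        sum_downward[of "false1 q" "- 1" N] sum_downward[of "false2 q" "- 1" N]
      by simp
  qed
  moreover have "\<forall>\<^sub>F s in at_right 0. G ?a 1 0 s + G ?b 11 2 s - G ?c 29 14 s - G ?d 19 6 s = H (q * of_real (exp (- s)))"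
    using eventually_at_right_less[of "0::real"] by eventually_elim (rule H)
  ultimately show ?thesis
    using Lim_transform_eventually by fastforce
qed

end

section \<open>The false theta functions of the theorem\<close>

lemma qpow_add: "qpow \<tau> (r + s) = qpow \<tau> r * qpow \<tau> s"
  by (simp add: qpow_def algebra_simps flip: exp_add)

lemma qpow_of_int: "qpow \<tau> (of_int k) = qpow \<tau> 1 powi k"
  unfolding qpow_def exp_power_int by (simp add: algebra_simps)

lemma unit_disc_qpow: "Im \<tau> > 0 \<Longrightarrow> unit_disc (qpow \<tau> 1)"
  by standard (simp_all add: qpow_def)

text \<open>The four cosets together form the integer lattice shifted by \<open>mu2\<close>;
  indexing by integer pairs turns the choice of a coset into a parity condition.\<close>

definition lpt :: "int \<times> int \<Rightarrow> real^2"
  where "lpt = (\<lambda>(a, b). vector [of_int a + 1/10, of_int b + 1/10])"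

lemma inj_lpt: "inj_on lpt A"
  by (auto simp: inj_on_def lpt_def vec_eq_iff forall_2)

lemma coset_eq:
  "(\<lambda>l. l + (mu2 + eps_vec \<epsilon>)) ` latL = lpt ` {(a, b). even (a - int (fst \<epsilon>)) \<and> even (b - int (snd \<epsilon>))}"
proof safe
  fix l assume "l \<in> latL"
  then obtain k1 k2 :: int where k: "l $ 1 = 2 * of_int k1" "l $ 2 = 2 * of_int k2"
    unfolding latL_def by blast
  show "l + (mu2 + eps_vec \<epsilon>) \<in> lpt ` {(a, b). even (a - int (fst \<epsilon>)) \<and> even (b - int (snd \<epsilon>))}"
    by (rule image_eqI[of _ _ "(2 * k1 + int (fst \<epsilon>), 2 * k2 + int (snd \<epsilon>))"])
       (simp_all add: lpt_def mu2_eq eps_vec_def vec_eq_iff forall_2 k)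
next
  fix a b assume "even (a - int (fst \<epsilon>))" "even (b - int (snd \<epsilon>))"
  then obtain k1 k2 where k: "a = 2 * k1 + int (fst \<epsilon>)" "b = 2 * k2 + int (snd \<epsilon>)"
    by (metis add.commute diff_add_cancel evenE)
  show "lpt (a, b) \<in> (\<lambda>l. l + (mu2 + eps_vec \<epsilon>)) ` latL"
  proof (rule image_eqI)
    show "vector [2 * of_int k1, 2 * of_int k2] \<in> latL"
      by (simp add: latL_def forall_2)
  qed (simp add: lpt_def mu2_eq eps_vec_def vec_eq_iff forall_2 k)
qed

text \<open>The constant is \<open>formQ mu2\<close>, and the cross term with \<open>mu2\<close>
  supplies the linear part \<open>(a + b) / 2\<close>.\<close>

lemma formQ_lpt: "formQ (lpt (a, b)) = 1/20 + of_int (pent a + pent b + 2 * a * b)"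
proof -
  have p: "real_of_int (pent r) = of_int r * (3 * of_int r + 1) / 2" for r
    using arg_cong[OF two_pent[of r], of real_of_int] by simp
  show ?thesis
    by (simp add: formQ_def formB_def lpt_def matA_def inner_vec_def matrix_vector_mult_def sum_2 p)
       (simp add: field_simps)
qed

text \<open>\<open>matA *v c1\<close> and \<open>matA *v c2\<close> are positive multiples of the
  coordinate vectors.\<close>

lemma isgn_lpt: "of_real (sgn (formB (lpt (a, b)) c1)) = isgn a" "of_real (sgn (formB (lpt (a, b)) c2)) = isgn b"
proof -
  have "formB (lpt (a, b)) c1 = 5 / sqrt 15 * (of_int a + 1/10)" "formB (lpt (a, b)) c2 = 5 / sqrt 15 * (of_int b + 1/10)"
    by (simp_all add: formB_def lpt_def matA_def c1_def c2_def inner_vec_def matrix_vector_mult_def sum_2 field_simps)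
  moreover have "sgn (of_int r + 1/10 :: real) = (if r \<ge> 0 then 1 else - 1)" for r :: int
  proof (cases "r \<ge> 0")
    case False
    then have "real_of_int r \<le> - 1" by linarith
    then show ?thesis using False by simp
  qed simp
  ultimately show "of_real (sgn (formB (lpt (a, b)) c1)) = isgn a" "of_real (sgn (formB (lpt (a, b)) c2)) = isgn b"
    by (simp_all add: sgn_mult isgn_def)
qed

text \<open>On each coset the sign \<open>(- 1) ^ (fst \<epsilon> + snd \<epsilon>)\<close> equals
  the sign \<open>(- 1) powi (a + b)\<close> inside \<open>dterm\<close>, and the four parity
  classes partition all integer pairs. Keeping \<open>g\<close> general covers both vectors
  \<open>c1\<close> and \<open>c2\<close>.\<close>

lemma sum_false_theta:
  assumes c: "\<And>a b. of_real (sgn (formB (lpt (a, b)) c)) = g (a, b)"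
    and S: "((\<lambda>(a, b). g (a, b) * dterm (qpow \<tau> 1) (a, b)) has_sum S) UNIV"
  shows "(\<Sum>\<epsilon>\<in>{0, 1} \<times> {0, 1}. (- 1) ^ (fst \<epsilon> + snd \<epsilon>) * false_theta (mu2 + eps_vec \<epsilon>) c \<tau>) = qpow \<tau> (1/20) * S"
proof -
  let ?q = "qpow \<tau> 1"
  define P where "P \<epsilon> = {(a, b). even (a - int (fst \<epsilon>)) \<and> even (b - int (snd \<epsilon>))}" for \<epsilon> :: "nat \<times> nat"
  let ?F = "\<lambda>x. g x * dterm ?q x"
  have nz: "?q \<noteq> 0" by (simp add: qpow_def)
  have F: "(?F has_sum S) UNIV" using S by (simp add: case_prod_unfold)
  have "(- 1) ^ (fst \<epsilon> + snd \<epsilon>) * false_theta (mu2 + eps_vec \<epsilon>) c \<tau> = qpow \<tau> (1/20) * infsum ?F (P \<epsilon>)" for \<epsilon>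
  proof -
    have "false_theta (mu2 + eps_vec \<epsilon>) c \<tau>
        = infsum ((\<lambda>n. of_real (sgn (formB n c)) * qpow \<tau> (formQ n)) \<circ> lpt) (P \<epsilon>)"
      unfolding false_theta_def coset_eq P_def by (rule infsum_reindex[OF inj_lpt])
    also have "\<dots> = infsum (\<lambda>x. ((- 1) ^ (fst \<epsilon> + snd \<epsilon>) * qpow \<tau> (1/20)) * ?F x) (P \<epsilon>)"
    proof (rule infsum_cong)
      fix x assume x: "x \<in> P \<epsilon>"
      obtain a b where ab: "x = (a, b)" by (cases x)
      have s: "(- 1 :: complex) ^ (fst \<epsilon> + snd \<epsilon>) = (- 1) powi (a + b)"
        using x by (auto simp: ab P_def minus_one_powi uminus_power_if)
      have "dterm ?q x = (- 1) powi (a + b) * ?q powi (pent a + pent b + 2 * a * b)"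
        using nz by (simp add: ab dterm_def pterm_def power_int_add)
      then have D: "(- 1) ^ (fst \<epsilon> + snd \<epsilon>) * dterm ?q (a, b) = ?q powi (pent a + pent b + 2 * a * b)"
        unfolding s by (simp add: ab minus_one_powi)
      then show "((\<lambda>n. of_real (sgn (formB n c)) * qpow \<tau> (formQ n)) \<circ> lpt) x
          = ((- 1) ^ (fst \<epsilon> + snd \<epsilon>) * qpow \<tau> (1/20)) * ?F x"
        unfolding o_def ab c formQ_lpt qpow_add qpow_of_int D[symmetric] by (simp only: mult_ac)
    qed
    also have "\<dots> = ((- 1) ^ (fst \<epsilon> + snd \<epsilon>) * qpow \<tau> (1/20)) * infsum ?F (P \<epsilon>)"
      by (rule infsum_cmult_right')
    finally show ?thesis
      by (simp add: power_mult_distrib[symmetric] flip: mult.assoc power_add)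
  qed
  then have "(\<Sum>\<epsilon>\<in>{0, 1} \<times> {0, 1}. (- 1) ^ (fst \<epsilon> + snd \<epsilon>) * false_theta (mu2 + eps_vec \<epsilon>) c \<tau>)
      = qpow \<tau> (1/20) * (\<Sum>\<epsilon>\<in>{0, 1} \<times> {0, 1}. infsum ?F (P \<epsilon>))"
    by (simp only: sum_distrib_left)
  also have "(\<Sum>\<epsilon>\<in>{0, 1} \<times> {0, 1}. infsum ?F (P \<epsilon>)) = infsum ?F (\<Union>\<epsilon>\<in>{0, 1} \<times> {0, 1}. P \<epsilon>)"
    by (rule sum_infsum)
       (auto simp: P_def intro: summable_on_subset_banach[OF has_sum_imp_summable[OF F]])
  also have "(\<Union>\<epsilon>\<in>{0, 1} \<times> {0, 1}. P \<epsilon>) = UNIV"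
    by (auto simp: P_def)
  finally show ?thesis using F by (simp add: infsumI)
qed

theorem mainTheorem4:
  shows "(\<forall>\<tau>::complex. Im \<tau> > 0 \<longrightarrow>
      H (qpow \<tau> 1) = qpow \<tau> (-1/120) / (2 * dedekind_eta \<tau>) *
        (\<Sum>\<epsilon>\<in>{0, 1} \<times> {0, 1}. (-1) ^ (fst \<epsilon> + snd \<epsilon>) *
           (false_theta (mu2 + eps_vec \<epsilon>) c1 \<tau> + false_theta (mu2 + eps_vec \<epsilon>) c2 \<tau>)) \<and>
      (\<Sum>\<epsilon>\<in>{0, 1} \<times> {0, 1}. (-1) ^ (fst \<epsilon> + snd \<epsilon>) * false_theta (mu2 + eps_vec \<epsilon>) c1 \<tau>) =
      (\<Sum>\<epsilon>\<in>{0, 1} \<times> {0, 1}. (-1) ^ (fst \<epsilon> + snd \<epsilon>) * false_theta (mu2 + eps_vec \<epsilon>) c2 \<tau>)) \<and>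
    (\<forall>N::nat. N > 0 \<longrightarrow>
      ((\<lambda>t::real. let \<tau> = 1 / of_nat N + \<i> * of_real t in
          qpow \<tau> (-1/120) / (2 * dedekind_eta \<tau>) *
          (\<Sum>\<epsilon>\<in>{0, 1} \<times> {0, 1}. (-1) ^ (fst \<epsilon> + snd \<epsilon>) * false_theta (mu2 + eps_vec \<epsilon>) c1 \<tau>))
        \<longlongrightarrow> H (exp (2 * of_real pi * \<i> / of_nat N))) (at_right 0) \<and>
      ((\<lambda>t::real. H (qpow (1 / of_nat N + \<i> * of_real t) 1))
        \<longlongrightarrow> 2 * H (exp (2 * of_real pi * \<i> / of_nat N))) (at_right 0))"
proof -
  let ?\<Theta> = "\<lambda>c \<tau>. \<Sum>\<epsilon>\<in>{0, 1} \<times> {0, 1}. (-1) ^ (fst \<epsilon> + snd \<epsilon>) * false_theta (mu2 + eps_vec \<epsilon>) c \<tau>"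
  let ?\<kappa> = "\<lambda>\<tau>. qpow \<tau> (-1/120) / (2 * dedekind_eta \<tau>)"
  have upper: "?\<Theta> c1 \<tau> = ?\<Theta> c2 \<tau>" "?\<kappa> \<tau> * ?\<Theta> c1 \<tau> = H (qpow \<tau> 1) / 2" if "Im \<tau> > 0" for \<tau>
  proof -
    interpret unit_disc "qpow \<tau> 1" using that by (rule unit_disc_qpow)
    have t1: "?\<Theta> c1 \<tau> = qpow \<tau> (1/20) * (euler_prod (qpow \<tau> 1) * H (qpow \<tau> 1))"
      by (rule sum_false_theta[where g = "\<lambda>(a, b). isgn a"])
         (use isgn_lpt has_sum_isgn_dterm in auto)
    have t2: "?\<Theta> c2 \<tau> = qpow \<tau> (1/20) * (euler_prod (qpow \<tau> 1) * H (qpow \<tau> 1))"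
      by (rule sum_false_theta[where g = "\<lambda>(a, b). isgn b"])
         (use isgn_lpt has_sum_isgn_dterm' in auto)
    from t1 t2 show "?\<Theta> c1 \<tau> = ?\<Theta> c2 \<tau>" by simp
    have eta: "dedekind_eta \<tau> = qpow \<tau> (1/24) * euler_prod (qpow \<tau> 1)"
      by (simp add: dedekind_eta_def euler_prod_def)
    \<comment> \<open>The fractional powers balance against the one in the eta function:
      \<open>- 1/120 + 1/20 = 1/24\<close>.\<close>
    have "qpow \<tau> (-1/120) * qpow \<tau> (1/20) = qpow \<tau> (1/24)"
      by (simp flip: qpow_add)
    moreover have "qpow \<tau> (1/24) \<noteq> 0" by (simp add: qpow_def)
    moreover have "?\<kappa> \<tau> * (qpow \<tau> (1/20) * (euler_prod (qpow \<tau> 1) * H (qpow \<tau> 1)))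
      = (qpow \<tau> (-1/120) * qpow \<tau> (1/20)) / qpow \<tau> (1/24) * (H (qpow \<tau> 1) / 2)"
      unfolding eta using euler_prod_nz by (simp add: field_simps)
    ultimately show "?\<kappa> \<tau> * ?\<Theta> c1 \<tau> = H (qpow \<tau> 1) / 2"
      unfolding t1 by simp
  qed
  have radial: "((\<lambda>t::real. H (qpow (1 / of_nat N + \<i> * of_real t) 1))
        \<longlongrightarrow> 2 * H (exp (2 * of_real pi * \<i> / of_nat N))) (at_right 0)" if "N > 0" for N :: nat
  proof -
    let ?\<zeta> = "exp (2 * of_real pi * \<i> / of_nat N)"
    interpret primitive_root ?\<zeta> N
    proof
      show "?\<zeta> ^ N = 1"
        unfolding exp_of_nat_mult[symmetric] using that by simp
      fix k assume k: "0 < k" "k < N"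
      show "?\<zeta> ^ k \<noteq> 1"
      proof
        assume "?\<zeta> ^ k = 1"
        then have "exp (of_nat k * (2 * of_real pi * \<i> / of_nat N)) = 1"
          by (simp only: exp_of_nat_mult)
        then obtain n :: int where "real k * (2 * pi / real N) = of_int (2 * n) * pi"
          unfolding exp_eq_1 by (auto simp: Im_divide_of_nat)
        then have "real k = of_int n * real N"
          using that by (simp add: field_simps)
        then have "int k = n * int N"
          by (metis of_int_eq_iff of_int_mult of_int_of_nat_eq)
        then have "int N dvd int k" by simp
        then show False using k by (auto dest: zdvd_imp_le)
      qed
    qed (rule that)
    \<comment> \<open>On the vertical line \<open>q = exp (2 pi i / N) * exp (- 2 pi t)\<close>, so
      the radial parameter of \<open>H_tendsto\<close> is \<open>2 * pi * t\<close>.\<close>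
    have "filterlim (\<lambda>t::real. 2 * pi * t) (at_right 0) (at_right 0)"
      by (rule filterlim_times_pos[OF filterlim_ident]) auto
    from filterlim_compose[OF H_tendsto this]
    have "((\<lambda>t. H (?\<zeta> * of_real (exp (- (2 * pi * t))))) \<longlongrightarrow> 2 * H ?\<zeta>) (at_right 0)" .
    moreover have "?\<zeta> * of_real (exp (- (2 * pi * t))) = qpow (1 / of_nat N + \<i> * of_real t) 1" for t :: real
      unfolding qpow_def exp_of_real[symmetric] exp_add[symmetric]
      by (rule arg_cong[where f = exp]) (simp add: field_simps)
    ultimately show ?thesis by simp
  qed
  have half: "((\<lambda>t::real. ?\<kappa> (1 / of_nat N + \<i> * of_real t) * ?\<Theta> c1 (1 / of_nat N + \<i> * of_real t))
        \<longlongrightarrow> H (exp (2 * of_real pi * \<i> / of_nat N))) (at_right 0)" if "N > 0" for N :: nat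
  proof (rule Lim_transform_eventually)
    \<comment> \<open>For \<open>t > 0\<close> the first half of the formula equals
      \<open>H / 2\<close>, so its limit is half of the radial limit of \<open>H\<close>.\<close>
    show "((\<lambda>t::real. H (qpow (1 / of_nat N + \<i> * of_real t) 1) / 2)
        \<longlongrightarrow> H (exp (2 * of_real pi * \<i> / of_nat N))) (at_right 0)"
      using tendsto_divide[OF radial[OF that] tendsto_const, of 2] by simp
    show "\<forall>\<^sub>F t in at_right 0. H (qpow (1 / of_nat N + \<i> * of_real t) 1) / 2
        = ?\<kappa> (1 / of_nat N + \<i> * of_real t) * ?\<Theta> c1 (1 / of_nat N + \<i> * of_real t)"
      using eventually_at_right_less[of "0::real"]
      by eventually_elim (rule upper(2)[symmetric], simp add: Im_divide_of_nat)
  qed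
  have full: "H (qpow \<tau> 1) = ?\<kappa> \<tau> * (\<Sum>\<epsilon>\<in>{0, 1} \<times> {0, 1}. (-1) ^ (fst \<epsilon> + snd \<epsilon>) *
           (false_theta (mu2 + eps_vec \<epsilon>) c1 \<tau> + false_theta (mu2 + eps_vec \<epsilon>) c2 \<tau>))" if "Im \<tau> > 0" for \<tau>
    unfolding distrib_left sum.distrib upper(1)[OF that, symmetric] upper(2)[OF that] by simp
  show ?thesis
    unfolding Let_def using full upper(1) radial half by blast
qed

end
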